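(* There exists an algorithm that, given any partially observable MDP $\mathcal{P}=(Q,\mathrm{Act},\mathrm{Sig},\delta)$ with goal state $q_{\mathrm{goal}}$ and initial state $q_0\in Q$, and any rational number $\epsilon>0$, returns a value $v$ with $|v-\mathbb{P}^{\inf}_{\mathcal{M}[\mathcal{P}],q_0}(\mathbf{F}\,G)|\le\epsilon$, where $\mathcal{M}[\mathcal{P}]$ is the belief MDP of $\mathcal{P}$, $G$ is the belief $q_{\mathrm{goal}}\mapsto 1$, and the infimum of the probability of reaching $G$ from the belief $q_0\mapsto 1$ ranges over all schedulers of $\mathcal{M}[\mathcal{P}]$.
   Context: An MDP is a tuple $(S,\mathrm{Act},P)$ with $S$, $\mathrm{Act}$ countable and $P:S\times\mathrm{Act}\times S\to[0,1]\cap\mathbb{Q}$ with $\sum_{s'}P(s,a,s')\in\{0,1\}$; $a$ is enabled at $s$ if the sum is $1$. Schedulers map finite histories of states to probability distributions over actions enabled in the last state. $\mathbf{F}\,G$ is the event that the path visits $G$. A partially observable MDP (POMDP) is a tuple $\mathcal{P}=(Q,\mathrm{Act},\mathrm{Sig},\delta)$ with $Q$, $\mathrm{Act}$, $\mathrm{Sig}$ finite sets of states, actions and signals, and $\delta:Q\times\mathrm{Act}\times\mathrm{Sig}\times Q\to[0,1]\cap\mathbb{Q}$ with $\sum_{o\in\mathrm{Sig}}\sum_{q'\in Q}\delta(q,a,o,q')=1$ for all $q,a$. Convention: there are a distinguished state $q_{\mathrm{goal}}\in Q$ and a distinguished signal $o_{\mathrm{goal}}\in\mathrm{Sig}$ such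 that $\delta(q,a,o,q_{\mathrm{goal}})>0$ implies $o=o_{\mathrm{goal}}$, and $\delta(q_{\mathrm{goal}},a,o_{\mathrm{goal}},q_{\mathrm{goal}})=1$ for all $a$; moreover observing $o_{\mathrm{goal}}$ informs the scheduler that $q_{\mathrm{goal}}$ has been reached, so that as soon as $q_{\mathrm{goal}}$ is reached in the POMDP, the belief is $q_{\mathrm{goal}}\mapsto1$. A belief is a probability distribution on $Q$ with rational values; $\mathcal{B}$ is the set of beliefs. The belief update is $\mathrm{upd}(b,a,o)(q')=\dfrac{\sum_{q}b(q)\delta(q,a,o,q')}{\sum_{q}b(q)\sum_{q''}\delta(q,a,o,q'')}$ (when the denominator is positive). The belief MDP is $\mathcal{M}[\mathcal{P}]=(\mathcal{B},\mathrm{Act},P_{\mathcal{P}})$ with $P_{\mathcal{P}}(b,a,b')=\sum_{o:\ \mathrm{upd}(b,a,o)=b'}\ \sum_{q,q'\in Q}b(q)\,\delta(q,a,o,q')$. *)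

theory Defs
  imports "HOL-Probability.Probability" "HOL-Library.Nat_Bijection"
begin

section \<open>Algorithms: partial recursive functions\<close>

datatype recf =
    Zero
  | Succ
  | Proj nat
  | Comp recf "recf list"
  | PrimRec recf recf
  | Mu recf

text \<open>\<open>eval f xs y\<close>: the program \<open>f\<close> halts on the arguments \<open>xs\<close> with output \<open>y\<close>. Recursion and
  minimisation run over the first argument; the step function of a primitive recursion receives
  the counter, the previous value and the parameters, in this order.\<close>

inductive eval :: "recf \<Rightarrow> nat list \<Rightarrow> nat \<Rightarrow> bool" where
  Zero: "eval Zero xs 0"
| Succ: "eval Succ (x # xs) (Suc x)"
| Proj: "i < length xs \<Longrightarrow> eval (Proj i) xs (xs ! i)"
| Comp: "list_all2 (\<lambda>g y. eval g xs y) gs ys \<Longrightarrow> eval f ys z \<Longrightarrow> eval (Comp f gs) xs z"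
| PrimRec_0: "eval f xs y \<Longrightarrow> eval (PrimRec f g) (0 # xs) y"
| PrimRec_Suc: "eval (PrimRec f g) (n # xs) y \<Longrightarrow> eval g (n # y # xs) z
    \<Longrightarrow> eval (PrimRec f g) (Suc n # xs) z"
| Mu: "eval f (n # xs) 0 \<Longrightarrow> (\<forall>m<n. \<exists>k. eval f (m # xs) (Suc k)) \<Longrightarrow> eval (Mu f) xs n"

inductive_cases eval_elims:
  "eval Zero xs y"
  "eval Succ xs y"
  "eval (Proj i) xs y"
  "eval (Comp f gs) xs y"
  "eval (PrimRec f g) (0 # xs) y"
  "eval (PrimRec f g) (Suc n # xs) y"
  "eval (Mu f) xs y"

lemma eval_deterministic: "eval f xs y \<Longrightarrow> eval f xs z \<Longrightarrow> y = z"
proof (induction arbitrary: z rule: eval.induct)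
  case (Zero xs)
  from Zero.prems show ?case by (rule eval_elims(1)) simp
next
  case (Succ x xs)
  from Succ.prems show ?case by (rule eval_elims(2)) simp
next
  case (Proj i xs)
  from Proj.prems show ?case by (rule eval_elims(3)) simp
next
  case (Comp xs gs ys f z')
  from Comp.prems obtain ys' where ys': "list_all2 (\<lambda>g y. eval g xs y) gs ys'" "eval f ys' z"
    by (rule eval_elims(4))
  have "ys = ys'"
    using Comp.IH(1) ys'(1) by (auto simp: list_all2_conv_all_nth intro!: nth_equalityI)
  with ys' Comp.IH(2) show ?case by blast
next
  case (PrimRec_0 f xs y g)
  from PrimRec_0.prems show ?case by (rule eval_elims(5)) (rule PrimRec_0.IH)
next
  case (PrimRec_Suc f g n xs y z')
  from PrimRec_Suc.prems obtain y' where "eval (PrimRec f g) (n # xs) y'" "eval g (n # y' # xs) z"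
    by (rule eval_elims(6))
  with PrimRec_Suc.IH show ?case by blast
next
  case (Mu f n xs)
  from Mu.prems have z: "eval f (z # xs) 0" "\<forall>m<z. \<exists>k. eval f (m # xs) (Suc k)"
    by (auto elim: eval_elims(7))
  show ?case
  proof (rule linorder_cases[of n z])
    assume "n < z"
    with z(2) Mu.IH(1) show ?thesis by fastforce
  next
    assume "z < n"
    with z(1) Mu.IH(2) show ?thesis by fastforce
  qed
qed


section \<open>Markov decision processes\<close>

record ('s, 'a) mdp =
  mstates :: "'s set"
  mactions :: "'a set"
  mtrans :: "'s \<Rightarrow> 'a \<Rightarrow> 's \<Rightarrow> rat"

definition mdp :: "('s, 'a) mdp \<Rightarrow> bool" where
  "mdp M \<longleftrightarrow> countable (mstates M) \<and> countable (mactions M) \<and>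
    (\<forall>s\<in>mstates M. \<forall>a\<in>mactions M.
      (\<forall>s'\<in>mstates M. 0 \<le> mtrans M s a s' \<and> mtrans M s a s' \<le> 1) \<and>
      (\<exists>x\<in>{0, 1}. ((\<lambda>s'. real_of_rat (mtrans M s a s')) has_sum x) (mstates M)))"

definition enabled :: "('s, 'a) mdp \<Rightarrow> 's \<Rightarrow> 'a set" where
  "enabled M s =
    {a \<in> mactions M. ((\<lambda>s'. real_of_rat (mtrans M s a s')) has_sum 1) (mstates M)}"

text \<open>A history is a nonempty list of states, oldest first. After a history that ends in a state
  without enabled actions there is nothing to choose, so the value there is unconstrained.\<close>

definition schedulers :: "('s, 'a) mdp \<Rightarrow> ('s list \<Rightarrow> 'a pmf) set" where
  "schedulers M = {\<sigma>. \<forall>h. h \<noteq> [] \<longrightarrow> set h \<subseteq> mstates M \<longrightarrow> enabled M (last h) \<noteq> {} \<longrightarrow>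
     set_pmf (\<sigma> h) \<subseteq> enabled M (last h)}"

text \<open>\<open>step_kernel M \<sigma> s0 i \<omega>\<close> is the conditional distribution of the \<open>i\<close>-th state, given the states
  \<open>\<omega> 0, \<dots>, \<omega> (i - 1)\<close>. A path ending in a state without enabled actions is represented by
  repeating that state forever, which leaves the set of visited states unchanged.\<close>

definition step_kernel ::
  "('s, 'a) mdp \<Rightarrow> ('s list \<Rightarrow> 'a pmf) \<Rightarrow> 's \<Rightarrow> nat \<Rightarrow> (nat \<Rightarrow> 's) \<Rightarrow> 's measure" where
  "step_kernel M \<sigma> s0 i \<omega> =
    (if i = 0 then return (count_space (mstates M)) s0
     else if enabled M (\<omega> (i - 1)) = {} then return (count_space (mstates M)) (\<omega> (i - 1))
     else point_measure (mstates M)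
       (\<lambda>s'. ennreal (\<integral>a. real_of_rat (mtrans M (\<omega> (i - 1)) a s') \<partial>measure_pmf (\<sigma> (map \<omega> [0..<i])))))"

text \<open>The measure on infinite paths given by the Ionescu-Tulcea theorem; the locale assumptions are
  verified in \<open>Ionescu_Tulcea_step_kernel\<close> below.\<close>

definition path_measure ::
  "('s, 'a) mdp \<Rightarrow> ('s list \<Rightarrow> 'a pmf) \<Rightarrow> 's \<Rightarrow> (nat \<Rightarrow> 's) measure" where
  "path_measure M \<sigma> s0 =
    projective_family.lim UNIV
      (Ionescu_Tulcea.CI (step_kernel M \<sigma> s0) (\<lambda>_. count_space (mstates M)))
      (\<lambda>_. count_space (mstates M))"

definition eventually_in :: "('s, 'a) mdp \<Rightarrow> 's set \<Rightarrow> (nat \<Rightarrow> 's) set" where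
  "eventually_in M G = {\<omega> \<in> space (PiM UNIV (\<lambda>_. count_space (mstates M))). \<exists>n. \<omega> n \<in> G}"

definition inf_reach :: "('s, 'a) mdp \<Rightarrow> 's \<Rightarrow> 's set \<Rightarrow> real" where
  "inf_reach M s0 G = (INF \<sigma>\<in>schedulers M. measure (path_measure M \<sigma> s0) (eventually_in M G))"

lemma schedulers_nonempty: "schedulers M \<noteq> {}"
proof -
  have "(\<lambda>h. return_pmf (SOME a. a \<in> enabled M (last h))) \<in> schedulers M"
    by (auto simp: schedulers_def intro: someI)
  then show ?thesis by blast
qed

lemma Ionescu_Tulcea_step_kernel:
  assumes M: "mdp M" and \<sigma>: "\<sigma> \<in> schedulers M" and s0: "s0 \<in> mstates M"
  shows "Ionescu_Tulcea (step_kernel M \<sigma> s0) (\<lambda>_. count_space (mstates M))"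
proof -
  let ?S = "mstates M"
  have S: "countable ?S" using M by (simp add: mdp_def)
  have sets: "sets (step_kernel M \<sigma> s0 i \<omega>) = Pow ?S" for i \<omega>
    by (simp add: step_kernel_def point_measure_def)
  have prob: "prob_space (step_kernel M \<sigma> s0 i \<omega>)" if \<omega>: "\<omega> \<in> {0..<i} \<rightarrow>\<^sub>E ?S" for i \<omega>
  proof -
    consider "i = 0" | "i \<noteq> 0" "enabled M (\<omega> (i - 1)) = {}" | "i \<noteq> 0" "enabled M (\<omega> (i - 1)) \<noteq> {}"
      by blast
    then show ?thesis
    proof cases
      case 3
      define s where "s = \<omega> (i - 1)"
      define h where "h = map \<omega> [0..<i]"
      have s: "s \<in> ?S" using \<omega> 3 by (auto simp: s_def PiE_iff)
      have last: "last h = s" using 3 by (simp add: h_def s_def last_map)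
      have *: "h \<noteq> [] \<longrightarrow> set h \<subseteq> ?S \<longrightarrow> enabled M (last h) \<noteq> {} \<longrightarrow>
          set_pmf (\<sigma> h) \<subseteq> enabled M (last h)"
        using \<sigma> unfolding schedulers_def by blast
      have "h \<noteq> []" "set h \<subseteq> ?S" "enabled M s \<noteq> {}"
        using \<omega> 3 by (auto simp: h_def s_def PiE_iff)
      with * have en: "set_pmf (\<sigma> h) \<subseteq> enabled M s"
        unfolding last by blast
      let ?p = "\<lambda>a s'. real_of_rat (mtrans M s a s')"
      have p: "0 \<le> ?p a s'" "?p a s' \<le> 1" if "a \<in> set_pmf (\<sigma> h)" "s' \<in> ?S" for a s'
        using M en s that by (auto simp: mdp_def enabled_def)
      have eq: "ennreal (\<integral>a. ?p a s' \<partial>measure_pmf (\<sigma> h)) = (\<integral>\<^sup>+a. ennreal (?p a s') \<partial>measure_pmf (\<sigma> h))"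
        if "s' \<in> ?S" for s'
        using p that
        by (intro nn_integral_eq_integral[symmetric] measure_pmf.integrable_const_bound[where B = 1])
           (auto intro!: AE_pmfI)
      have one: "(\<integral>\<^sup>+s'. ennreal (?p a s') \<partial>count_space ?S) = 1" if a: "a \<in> set_pmf (\<sigma> h)" for a
      proof -
        have hs: "(?p a has_sum 1) ?S" using en a by (auto simp: enabled_def)
        then have "(\<lambda>s'. norm (?p a s')) summable_on ?S"
          using p[OF a] by (subst summable_on_cong[of _ _ "?p a"]) (auto simp: summable_on_def)
        then have "integrable (count_space ?S) (?p a)"
          using abs_summable_equivalent abs_summable_on_def by blast
        then have "(\<integral>\<^sup>+s'. ennreal (?p a s') \<partial>count_space ?S) = ennreal (\<integral>s'. ?p a s' \<partial>count_space ?S)"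
          by (intro nn_integral_eq_integral) (use p[OF a] in \<open>auto simp: AE_count_space\<close>)
        also have "(\<integral>s'. ?p a s' \<partial>count_space ?S) = infsum (?p a) ?S"
          using \<open>(\<lambda>s'. norm (?p a s')) summable_on ?S\<close>
          unfolding infsetsum_def[symmetric] abs_summable_equivalent by (rule infsetsum_infsum)
        also have "\<dots> = 1" using hs by (rule infsumI)
        finally show ?thesis by simp
      qed
      have "step_kernel M \<sigma> s0 i \<omega> = point_measure ?S (\<lambda>s'. ennreal (\<integral>a. ?p a s' \<partial>measure_pmf (\<sigma> h)))"
        using 3 by (simp add: step_kernel_def s_def h_def)
      then have "emeasure (step_kernel M \<sigma> s0 i \<omega>) ?S
        = (\<integral>\<^sup>+s'. ennreal (\<integral>a. ?p a s' \<partial>measure_pmf (\<sigma> h)) \<partial>count_space ?S)"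
        by (simp add: point_measure_def emeasure_density cong: nn_integral_cong_simp)
      also have "\<dots> = (\<integral>\<^sup>+s'. (\<integral>\<^sup>+a. ennreal (?p a s') \<partial>measure_pmf (\<sigma> h)) \<partial>count_space ?S)"
        by (intro nn_integral_cong) (simp add: eq)
      also have "\<dots> = (\<integral>\<^sup>+a. (\<integral>\<^sup>+s'. ennreal (?p a s') \<partial>count_space ?S) \<partial>measure_pmf (\<sigma> h))"
        using S by (intro nn_integral_count_space_nn_integral[symmetric]) auto
      also have "\<dots> = (\<integral>\<^sup>+a. 1 \<partial>measure_pmf (\<sigma> h))"
        by (intro nn_integral_cong_AE AE_pmfI one)
      also have "\<dots> = 1" by (simp add: measure_pmf.emeasure_space_1)
      finally show ?thesis
        using sets_eq_imp_space_eq[of "step_kernel M \<sigma> s0 i \<omega>" "count_space ?S"] sets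
        by (intro prob_spaceI) simp
    qed (use \<omega> s0 in \<open>auto simp: step_kernel_def PiE_iff intro!: prob_space_return\<close>)
  qed
  show ?thesis
  proof (rule Ionescu_Tulcea.intro)
    fix i :: nat
    have PiM: "PiM {0..<i} (\<lambda>_. count_space ?S) = count_space ({0..<i} \<rightarrow>\<^sub>E ?S)"
      by (rule count_space_PiM_finite) (auto simp: S)
    show "step_kernel M \<sigma> s0 i \<in> PiM {0..<i} (\<lambda>_. count_space ?S) \<rightarrow>\<^sub>M subprob_algebra (count_space ?S)"
      unfolding PiM
      by (auto simp: space_subprob_algebra sets prob prob_space_imp_subprob_space)
    fix x assume "x \<in> space (PiM {0..<i} (\<lambda>_. count_space ?S))"
    then show "prob_space (step_kernel M \<sigma> s0 i x)"
      using prob unfolding PiM by simp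
  qed
qed

lemma prob_space_path_measure:
  assumes "mdp M" "\<sigma> \<in> schedulers M" "s0 \<in> mstates M"
  shows "prob_space (path_measure M \<sigma> s0)"
    and "sets (path_measure M \<sigma> s0) = sets (PiM UNIV (\<lambda>_. count_space (mstates M)))"
proof -
  interpret Ionescu_Tulcea "step_kernel M \<sigma> s0" "\<lambda>_. count_space (mstates M)"
    using assms by (rule Ionescu_Tulcea_step_kernel)
  show s: "sets (path_measure M \<sigma> s0) = sets (PiM UNIV (\<lambda>_. count_space (mstates M)))"
    by (simp add: path_measure_def)
  have "emeasure PF.lim (PF.emb UNIV {} (space (PiM {} (\<lambda>_. count_space (mstates M)))))
      = emeasure (CI {}) (space (PiM {} (\<lambda>_. count_space (mstates M))))"
    by (rule lim) auto
  moreover interpret C: prob_space "CI {}" by (rule PF.prob_space_P) auto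
  have "space (CI {}) = space (PiM {} (\<lambda>_. count_space (mstates M)))" by (simp add: CI_def)
  moreover have "PF.emb UNIV {} (space (PiM {} (\<lambda>_. count_space (mstates M))))
      = space (PiM UNIV (\<lambda>_. count_space (mstates M)))"
    by (auto simp: prod_emb_def space_PiM restrict_def)
  ultimately have "emeasure PF.lim (space (PiM UNIV (\<lambda>_. count_space (mstates M)))) = 1"
    using C.emeasure_space_1 by simp
  then show "prob_space (path_measure M \<sigma> s0)"
    using sets_eq_imp_space_eq[OF s] by (intro prob_spaceI) (simp add: path_measure_def)
qed

lemma eventually_in_measurable:
  "eventually_in M G \<in> sets (PiM UNIV (\<lambda>_. count_space (mstates M)))"
proof -
  have *: "eventually_in M G =
    (\<Union>n. (\<lambda>\<omega>. \<omega> n) -` (G \<inter> mstates M) \<inter> space (PiM UNIV (\<lambda>_. count_space (mstates M))))"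
    by (auto simp: eventually_in_def space_PiM PiE_iff)
  show ?thesis
    unfolding *
  proof (rule sets.countable_UN)
    show "range (\<lambda>n. (\<lambda>\<omega>. \<omega> n) -` (G \<inter> mstates M) \<inter>
        space (PiM UNIV (\<lambda>_. count_space (mstates M)))) \<subseteq> sets (PiM UNIV (\<lambda>_. count_space (mstates M)))"
      by (intro image_subsetI
        measurable_sets[OF measurable_component_singleton[where M = "\<lambda>_. count_space (mstates M)"]])
        simp_all
  qed
qed


section \<open>Partially observable Markov decision processes\<close>

record ('q, 'a, 'o) pomdp =
  pstates :: "'q set"
  pactions :: "'a set"
  psignals :: "'o set"
  ptrans :: "'q \<Rightarrow> 'a \<Rightarrow> 'o \<Rightarrow> 'q \<Rightarrow> rat"
  pgoal :: 'q
  pgoal_signal :: 'o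

text \<open>The last condition says that the goal signal is emitted only on reaching the goal state, i.e.\
  that observing it informs the scheduler that the goal has been reached.\<close>

definition pomdp :: "('q, 'a, 'o) pomdp \<Rightarrow> bool" where
  "pomdp P \<longleftrightarrow>
    finite (pstates P) \<and> finite (pactions P) \<and> finite (psignals P) \<and>
    pgoal P \<in> pstates P \<and> pgoal_signal P \<in> psignals P \<and>
    (\<forall>q\<in>pstates P. \<forall>a\<in>pactions P. \<forall>s\<in>psignals P. \<forall>q'\<in>pstates P.
      0 \<le> ptrans P q a s q' \<and> ptrans P q a s q' \<le> 1) \<and>
    (\<forall>q\<in>pstates P. \<forall>a\<in>pactions P.
      (\<Sum>s\<in>psignals P. \<Sum>q'\<in>pstates P. ptrans P q a s q') = 1) \<and>
    (\<forall>q\<in>pstates P. \<forall>a\<in>pactions P. \<forall>s\<in>psignals P.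
      ptrans P q a s (pgoal P) > 0 \<longrightarrow> s = pgoal_signal P) \<and>
    (\<forall>a\<in>pactions P. ptrans P (pgoal P) a (pgoal_signal P) (pgoal P) = 1) \<and>
    (\<forall>q\<in>pstates P. \<forall>a\<in>pactions P. \<forall>q'\<in>pstates P.
      ptrans P q a (pgoal_signal P) q' > 0 \<longrightarrow> q' = pgoal P)"

text \<open>Beliefs are extended by \<open>0\<close> outside the finite state set, so that equal distributions are equal
  functions.\<close>

definition beliefs :: "('q, 'a, 'o) pomdp \<Rightarrow> ('q \<Rightarrow> rat) set" where
  "beliefs P = {b. (\<forall>q\<in>pstates P. 0 \<le> b q) \<and> (\<forall>q. q \<notin> pstates P \<longrightarrow> b q = 0) \<and>
     (\<Sum>q\<in>pstates P. b q) = 1}"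

definition point_belief :: "'q \<Rightarrow> 'q \<Rightarrow> rat" where
  "point_belief q = (\<lambda>q'. if q' = q then 1 else 0)"

text \<open>When the denominator vanishes, \<open>upd\<close> is the zero function, which is not a belief.\<close>

definition upd :: "('q, 'a, 'o) pomdp \<Rightarrow> ('q \<Rightarrow> rat) \<Rightarrow> 'a \<Rightarrow> 'o \<Rightarrow> 'q \<Rightarrow> rat" where
  "upd P b a s = (\<lambda>q'. if q' \<in> pstates P then
      (\<Sum>q\<in>pstates P. b q * ptrans P q a s q') /
      (\<Sum>q\<in>pstates P. b q * (\<Sum>q''\<in>pstates P. ptrans P q a s q''))
    else 0)"

definition belief_mdp :: "('q, 'a, 'o) pomdp \<Rightarrow> ('q \<Rightarrow> rat, 'a) mdp" where
  "belief_mdp P = \<lparr>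
     mstates = beliefs P,
     mactions = pactions P,
     mtrans = (\<lambda>b a b'. \<Sum>s | s \<in> psignals P \<and> upd P b a s = b'.
        \<Sum>q\<in>pstates P. \<Sum>q'\<in>pstates P. b q * ptrans P q a s q') \<rparr>"

lemma point_belief_in_beliefs: "pomdp P \<Longrightarrow> q \<in> pstates P \<Longrightarrow> point_belief q \<in> beliefs P"
  by (auto simp: beliefs_def point_belief_def pomdp_def)

lemma countable_beliefs:
  assumes "finite (pstates P)"
  shows "countable (beliefs P)"
proof (rule countable_image_inj_on)
  have "(\<lambda>b. restrict b (pstates P)) ` beliefs P \<subseteq> pstates P \<rightarrow>\<^sub>E UNIV" by auto
  moreover have "countable (pstates P \<rightarrow>\<^sub>E (UNIV :: rat set))"
    by (intro countable_PiE assms) auto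
  ultimately show "countable ((\<lambda>b. restrict b (pstates P)) ` beliefs P)"
    by (rule countable_subset)
  show "inj_on (\<lambda>b. restrict b (pstates P)) (beliefs P)"
  proof (rule inj_onI, rule ext)
    fix b c q
    assume b: "b \<in> beliefs P" and c: "c \<in> beliefs P"
      and eq: "restrict b (pstates P) = restrict c (pstates P)"
    show "b q = c q"
    proof (cases "q \<in> pstates P")
      case True
      with fun_cong[OF eq, of q] show ?thesis by simp
    qed (use b c in \<open>auto simp: beliefs_def\<close>)
  qed
qed

lemma belief_mdp_enabled:
  assumes P: "pomdp P" and b: "b \<in> beliefs P" and a: "a \<in> pactions P"
  shows "(\<forall>b'. 0 \<le> mtrans (belief_mdp P) b a b' \<and> mtrans (belief_mdp P) b a b' \<le> 1) \<and>
    ((\<lambda>b'. real_of_rat (mtrans (belief_mdp P) b a b')) has_sum 1) (beliefs P)"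
proof -
  let ?Q = "pstates P" and ?O = "psignals P" and ?p = "mtrans (belief_mdp P) b a"
  have fin: "finite ?Q" "finite ?O" using P by (auto simp: pomdp_def)
  define w where "w s = (\<Sum>q\<in>?Q. \<Sum>q'\<in>?Q. b q * ptrans P q a s q')" for s
  have nonneg: "0 \<le> b q * ptrans P q a s q'" if "q \<in> ?Q" "s \<in> ?O" "q' \<in> ?Q" for q s q'
    using P b a that by (auto simp: pomdp_def beliefs_def)
  have w0: "0 \<le> w s" if "s \<in> ?O" for s
    unfolding w_def using nonneg that by (intro sum_nonneg) auto
  have p: "?p b' = (\<Sum>s | s \<in> ?O \<and> upd P b a s = b'. w s)" for b'
    by (simp add: belief_mdp_def w_def)
  have "sum w ?O = (\<Sum>q\<in>?Q. b q * (\<Sum>s\<in>?O. \<Sum>q'\<in>?Q. ptrans P q a s q'))"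
    unfolding w_def by (subst sum.swap) (simp add: sum_distrib_left)
  also have "\<dots> = (\<Sum>q\<in>?Q. b q * 1)"
    using P a by (intro sum.cong refl) (auto simp: pomdp_def)
  also have "\<dots> = 1" using b by (simp add: beliefs_def)
  finally have w1: "sum w ?O = 1" .
  have upd: "upd P b a s \<in> beliefs P" if s: "s \<in> ?O" "w s \<noteq> 0" for s
  proof -
    have w: "w s = (\<Sum>q\<in>?Q. b q * (\<Sum>q''\<in>?Q. ptrans P q a s q''))"
      by (simp add: w_def sum_distrib_left)
    have "w s = (\<Sum>q'\<in>?Q. \<Sum>q\<in>?Q. b q * ptrans P q a s q')"
      unfolding w_def by (rule sum.swap)
    then have "(\<Sum>q'\<in>?Q. upd P b a s q') = w s / w s"
      by (simp add: upd_def w[symmetric] sum_divide_distrib[symmetric])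
    with s w0[OF s(1)] nonneg show ?thesis
      unfolding beliefs_def by (auto simp: upd_def w[symmetric] intro!: divide_nonneg_nonneg sum_nonneg)
  qed
  let ?B = "upd P b a ` {s \<in> ?O. w s \<noteq> 0}"
  have "sum ?p ?B = (\<Sum>b'\<in>?B. \<Sum>s | s \<in> {s \<in> ?O. w s \<noteq> 0} \<and> upd P b a s = b'. w s)"
    unfolding p using fin by (intro sum.cong refl sum.mono_neutral_right) auto
  also have "\<dots> = sum w {s \<in> ?O. w s \<noteq> 0}"
    using fin by (intro sum.image_gen[symmetric]) auto
  also have "\<dots> = sum w ?O" using fin by (intro sum.mono_neutral_left) auto
  finally have sum1: "sum ?p ?B = 1" using w1 by simp
  have zero: "?p b' = 0" if "b' \<notin> ?B" for b'
    unfolding p using that by (intro sum.neutral) auto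
  have "((\<lambda>b'. real_of_rat (?p b')) has_sum (\<Sum>b'\<in>?B. real_of_rat (?p b'))) (beliefs P)"
    using fin upd zero by (intro has_sum_finite_neutralI) auto
  moreover have "(\<Sum>b'\<in>?B. real_of_rat (?p b')) = 1"
    using sum1 by (simp add: of_rat_sum[symmetric])
  moreover have "0 \<le> ?p b'" for b' unfolding p using w0 by (intro sum_nonneg) auto
  moreover have "?p b' \<le> 1" for b'
    unfolding p w1[symmetric] using w0 fin by (intro sum_mono2) auto
  ultimately show ?thesis by simp
qed

lemma mdp_belief_mdp: "pomdp P \<Longrightarrow> mdp (belief_mdp P)"
proof -
  assume P: "pomdp P"
  have st: "mstates (belief_mdp P) = beliefs P" "mactions (belief_mdp P) = pactions P"
    by (simp_all add: belief_mdp_def)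
  have "countable (beliefs P)" "countable (pactions P)"
    using P by (simp_all add: pomdp_def countable_beliefs countable_finite)
  then show ?thesis
    unfolding mdp_def st using belief_mdp_enabled[OF P] by blast
qed


section \<open>Instances as inputs\<close>

definition rat_of_code :: "nat \<Rightarrow> rat" where
  "rat_of_code c = (case prod_decode c of (m, n) \<Rightarrow> of_int (int_decode m) / of_nat (Suc n))"

text \<open>An input consists of \<open>\<epsilon>\<close>, the numbers of states, actions and signals, the positions of the
  initial state, the goal state and the goal signal in some enumerations, and the table of all
  transition probabilities in lexicographic order of these enumerations. Fractions need not be in
  lowest terms.\<close>

definition encodes :: "nat list \<Rightarrow> ('q, 'a, 'o) pomdp \<Rightarrow> 'q \<Rightarrow> rat \<Rightarrow> bool" where
  "encodes x P q0 \<epsilon> \<longleftrightarrow> (\<exists>qs acts sigs e i g k t.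
     distinct qs \<and> set qs = pstates P \<and>
     distinct acts \<and> set acts = pactions P \<and>
     distinct sigs \<and> set sigs = psignals P \<and>
     rat_of_code e = \<epsilon> \<and>
     i < length qs \<and> qs ! i = q0 \<and>
     g < length qs \<and> qs ! g = pgoal P \<and>
     k < length sigs \<and> sigs ! k = pgoal_signal P \<and>
     map rat_of_code t = [ptrans P q a s q'. q \<leftarrow> qs, a \<leftarrow> acts, s \<leftarrow> sigs, q' \<leftarrow> qs] \<and>
     x = [e, length qs, length acts, length sigs, i, g, k, list_encode t])"

lemma surj_rat_of_code: "surj rat_of_code"
proof (rule surjI)
  fix r :: rat
  let ?c = "prod_encode (int_encode (fst (quotient_of r)), nat (snd (quotient_of r)) - 1)"
  have pos: "snd (quotient_of r) > 0" by (rule quotient_of_denom_pos')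
  then have "of_nat (Suc (nat (snd (quotient_of r)) - 1)) = (of_int (snd (quotient_of r)) :: rat)"
    by simp
  moreover have "r = of_int (fst (quotient_of r)) / of_int (snd (quotient_of r))"
    by (rule quotient_of_div) simp
  ultimately show "rat_of_code ?c = r" by (simp add: rat_of_code_def del: of_nat_Suc)
qed

lemma encodes_exists:
  assumes P: "pomdp P" and q0: "q0 \<in> pstates P"
  shows "\<exists>x. encodes x P q0 \<epsilon>"
proof -
  from P have "finite (pstates P)" "finite (pactions P)" "finite (psignals P)"
    and g: "pgoal P \<in> pstates P" "pgoal_signal P \<in> psignals P"
    by (simp_all add: pomdp_def)
  then obtain qs acts sigs where l: "set qs = pstates P" "distinct qs" "set acts = pactions P"
    "distinct acts" "set sigs = psignals P" "distinct sigs"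
    by (metis finite_distinct_list)
  obtain i where i: "i < length qs" "qs ! i = q0"
    using q0 unfolding l(1)[symmetric] in_set_conv_nth by blast
  obtain j where j: "j < length qs" "qs ! j = pgoal P"
    using g(1) unfolding l(1)[symmetric] in_set_conv_nth by blast
  obtain k where k: "k < length sigs" "sigs ! k = pgoal_signal P"
    using g(2) unfolding l(5)[symmetric] in_set_conv_nth by blast
  obtain e where e: "rat_of_code e = \<epsilon>" using surj_rat_of_code by (metis surjD)
  have t: "map rat_of_code (map (inv rat_of_code) xs) = xs" for xs
    by (simp only: map_map surj_iff[THEN iffD1, OF surj_rat_of_code] list.map_id)
  show ?thesis
    unfolding encodes_def by (intro exI conjI) (rule l i j k e t refl)+
qed

end

(*
  Replace beliefs by unnormalised vectors alpha on the states. The minimal probability of being in the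
  goal state after n steps is val n alpha with val (Suc n) alpha = min_a sum_s val n (push alpha a s). It
  is homogeneous in alpha, and the infimum over all schedulers is the limit lval of the increasing sequence
  val n: val (n - i) at time i is a submartingale under every scheduler, and lval is a supermartingale
  under the scheduler that is greedy for it.

  The limit is approached at a computable rate. Let N = 2^|Q| and split off the states carrying a
  fraction below 1 / (E |Q|) of the mass of alpha. On the set U of the other states, either the goal can
  be avoided forever, and then lval alpha <= mass alpha / E, or every scheduler moves weight at least D^-N
  from the indicator vector of U into it within N steps, where D is a common denominator of the transition
  probabilities. The second case can occur in few blocks of N steps only, since each time it costs a
  fixed fraction of the mass that has not reached the goal. So an explicit horizon n suffices.

  Finally val n is the minimum of finitely many linear functionals, one per plan tree of depth n. Scaled
  by D^n they have natural coefficients, which are tabulated as the digits of one natural number, so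
  the whole computation is primitive recursive.
*)

theory Submission
  imports Defs
begin

text \<open>The values \<open>val n\<close> approach the infimum only from below, and infinitely
  many beliefs may be reachable, so computing them until they settle gives no stopping rule; hence
  the a priori rate. It rests on the fact that whether the goal can be avoided forever depends only
  on the set of states that carry weight, and there are finitely many such sets. The weights
  themselves have no positive lower bound, which is why states with little weight are split off at a
  cost proportional to the mass.

  Without normalisation a step is linear and free of division: signals of probability 0 need no
  exception, and costs proportional to the mass add up over the branches of a plan.

  A belief with only part of its weight on the goal is not the target belief, although
  \<open>val\<close> counts that part. The goal signal excludes such beliefs after every
  observation, and the start is a point belief, so only vectors with none or all of their weight on
  the goal matter.\<close>

section \<open>Closure properties of computable functions\<close>

text \<open>The arguments of the program are the values of the variables \<open>ps\<close> in an environment of any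
  type. A binder extends the environment by a component, so closure rules apply to terms with
  bound variables without de Bruijn indices.\<close>

definition computable :: "('e \<Rightarrow> nat) list \<Rightarrow> ('e \<Rightarrow> nat) \<Rightarrow> bool" where
  "computable ps f \<longleftrightarrow> (\<exists>r. \<forall>e. eval r (map (\<lambda>p. p e) ps) (f e))"

lemma computable_var:
  assumes "p \<in> set ps"
  shows "computable ps p"
proof -
  obtain i where i: "i < length ps" "ps ! i = p" using assms by (auto simp: in_set_conv_nth)
  have "eval (Proj i) (map (\<lambda>p. p e) ps) (p e)" for e
    using eval.Proj[of i "map (\<lambda>p. p e) ps"] i by simp
  then show ?thesis unfolding computable_def by blast
qed

text \<open>Programs compose. As \<open>h\<close> may lead between environments of different types,
  this one rule yields weakening, permutation and substitution.\<close>

lemma computable_subst: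
  assumes f: "computable qs f" and qs: "\<And>q. q \<in> set qs \<Longrightarrow> computable ps (\<lambda>e. q (h e))"
  shows "computable ps (\<lambda>e. f (h e))"
proof -
  obtain r where r: "\<And>e. eval r (map (\<lambda>p. p e) qs) (f e)"
    using f unfolding computable_def by blast
  have "\<forall>q\<in>set qs. \<exists>r. \<forall>e. eval r (map (\<lambda>p. p e) ps) (q (h e))"
    using qs unfolding computable_def by blast
  then obtain R where R: "\<And>q e. q \<in> set qs \<Longrightarrow> eval (R q) (map (\<lambda>p. p e) ps) (q (h e))"
    by metis
  have "eval (Comp r (map R qs)) (map (\<lambda>p. p e) ps) (f (h e))" for e
  proof (rule eval.Comp)
    show "list_all2 (\<lambda>g y. eval g (map (\<lambda>p. p e) ps) y) (map R qs) (map (\<lambda>p. p (h e)) qs)"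
      by (auto simp: list_all2_conv_all_nth R)
  qed (rule r)
  then show ?thesis unfolding computable_def by blast
qed

named_theorems computable

lemma computable_head [computable]: "computable (p # ps) p"
  by (rule computable_var) simp

lemma computable_second [computable]: "computable (p # q # ps) q"
  by (rule computable_var) simp

text \<open>A term without the bound variable sees the environment only through \<open>snd\<close>;
  the shape \<open>map (\<lambda>p. p \<circ> snd) ps\<close> lets unification recognise the
  binder.\<close>

lemma computable_weaken [computable]:
  assumes "computable ps f"
  shows "computable (p # map (\<lambda>p. p \<circ> snd) ps) (\<lambda>e. f (snd e))"
  by (rule computable_subst[OF assms]) (auto intro!: computable_var simp: comp_def)

lemma computable_weaken2 [computable]:
  assumes "computable ps f"
  shows "computable (p # q # map (\<lambda>p. p \<circ> (\<lambda>e. snd (snd e))) ps) (\<lambda>e. f (snd (snd e)))"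
  by (rule computable_subst[OF assms]) (auto intro!: computable_var simp: comp_def)

lemma computable_instance:
  assumes f: "computable (fst # map (\<lambda>p. p \<circ> snd) ps) (\<lambda>e. f (fst e) (snd e))"
    and g: "computable qs g" and k: "\<And>p. p \<in> set ps \<Longrightarrow> computable qs (\<lambda>e. p (k e))"
  shows "computable qs (\<lambda>e. f (g e) (k e))"
proof -
  have "computable qs (\<lambda>e. q (g e, k e))" if "q \<in> set (fst # map (\<lambda>p. p \<circ> snd) ps)" for q
    using that g k by (auto simp: comp_def)
  from computable_subst[OF f, where h = "\<lambda>e. (g e, k e)", OF this] show ?thesis by simp
qed

text \<open>Sums, products and minima become recursions whose step binds a counter and an
  accumulator. This rule reuses the body \<open>f\<close> under these two binders.\<close>

lemma computable_bound:
  assumes f: "computable (fst # map (\<lambda>p. p \<circ> snd) ps) (\<lambda>e. f (fst e) (snd e))"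
    and g: "computable (p # q # map (\<lambda>p. p \<circ> (\<lambda>e. snd (snd e))) ps) g"
  shows "computable (p # q # map (\<lambda>p. p \<circ> (\<lambda>e. snd (snd e))) ps) (\<lambda>e. f (g e) (snd (snd e)))"
  by (rule computable_instance[OF f g]) (auto intro!: computable_var simp: comp_def)

section \<open>Primitive recursive arithmetic\<close>

lemma computable_Suc [computable]:
  assumes "computable ps f" shows "computable ps (\<lambda>e. Suc (f e))"
proof -
  have "computable [id] Suc"
    unfolding computable_def using eval.Succ by auto
  from computable_subst[OF this, of ps f] assms show ?thesis by simp
qed

lemma computable_const [computable]: "computable ps (\<lambda>_. c)"
proof (induction c)
  case 0
  then show ?case unfolding computable_def using eval.Zero by blast
qed (rule computable_Suc)

lemma computable_rec [computable]:
  assumes "computable ps a"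
    and h: "computable (fst # (\<lambda>e. fst (snd e)) # map (\<lambda>p. p \<circ> (\<lambda>e. snd (snd e))) ps)
      (\<lambda>e. h (fst e) (fst (snd e)) (snd (snd e)))"
    and n: "computable ps n"
  shows "computable ps (\<lambda>e. rec_nat (a e) (\<lambda>m y. h m y e) (n e))"
proof -
  obtain ra where ra: "\<And>e. eval ra (map (\<lambda>p. p e) ps) (a e)"
    using assms(1) unfolding computable_def by blast
  obtain rh where rh: "\<And>m y e. eval rh (m # y # map (\<lambda>p. p e) ps) (h m y e)"
    using h unfolding computable_def by (auto simp: comp_def)
  have "eval (PrimRec ra rh) (m # map (\<lambda>p. p e) ps) (rec_nat (a e) (\<lambda>m y. h m y e) m)" for m e
    by (induction m) (auto intro: eval.intros ra rh)
  \<comment> \<open>\<open>PrimRec\<close> recurses over its first argument, so the bound is a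
    variable at first; \<open>computable_instance\<close> then puts \<open>n\<close> in its
    place.\<close>
  then have "computable (fst # map (\<lambda>p. p \<circ> snd) ps)
      (\<lambda>e. rec_nat (a (snd e)) (\<lambda>m y. h m y (snd e)) (fst e))"
    unfolding computable_def by (auto simp: comp_def)
  from computable_instance[OF this n computable_var] show ?thesis by simp
qed

lemma computable_add [computable]:
  assumes [computable]: "computable ps f" "computable ps g" shows "computable ps (\<lambda>e. f e + g e)"
proof -
  have "a + b = rec_nat a (\<lambda>_ y. Suc y) b" for a b :: nat by (induction b) auto
  then show ?thesis by (simp only:) (intro computable)
qed

lemma computable_mult [computable]:
  assumes [computable]: "computable ps f" "computable ps g" shows "computable ps (\<lambda>e. f e * g e)"
proof -
  have "a * b = rec_nat 0 (\<lambda>_ y. y + a) b" for a b :: nat by (induction b) auto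
  then show ?thesis by (simp only:) (intro computable)
qed

lemma computable_power [computable]:
  assumes [computable]: "computable ps f" "computable ps g" shows "computable ps (\<lambda>e. f e ^ g e)"
proof -
  have "a ^ b = rec_nat 1 (\<lambda>_ y. y * a) b" for a b :: nat by (induction b) auto
  then show ?thesis by (simp only:) (intro computable)
qed

lemma computable_diff [computable]:
  assumes [computable]: "computable ps f" "computable ps g" shows "computable ps (\<lambda>e. f e - g e)"
proof -
  \<comment> \<open>The inner recursion returns its last counter value, which is the predecessor of
    \<open>y\<close>.\<close>
  have "a - b = rec_nat a (\<lambda>_ y. rec_nat 0 (\<lambda>m _. m) y) b" for a b :: nat
  proof (induction b)
    case (Suc b)
    have "rec_nat 0 (\<lambda>m _. m) y = y - 1" for y :: nat by (cases y) auto
    then show ?case using Suc by simp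
  qed simp
  then show ?thesis by (simp only:) (intro computable)
qed

lemma computable_if_le [computable]:
  assumes [computable]: "computable ps a" "computable ps b" "computable ps f" "computable ps g"
  shows "computable ps (\<lambda>e. if a e \<le> b e then f e else g e)"
proof -
  \<comment> \<open>With truncated subtraction, \<open>1 - (x - y)\<close> is the characteristic
    function of x \<le> y.\<close>
  have "(if x \<le> y then u else v) = u * (1 - (x - y)) + v * (1 - (1 - (x - y)))" for x y u v :: nat
    by auto
  then show ?thesis by (simp only:) (intro computable)
qed

lemma computable_if_eq [computable]:
  assumes [computable]: "computable ps a" "computable ps b" "computable ps f" "computable ps g"
  shows "computable ps (\<lambda>e. if a e = b e then f e else g e)"
proof -
  have "(if x = y then u else v) = (if x \<le> y then if y \<le> x then u else v else v)" for x y u v :: nat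
    by auto
  then show ?thesis by (simp only:) (intro computable)
qed

lemma computable_sum [computable]:
  assumes [computable]: "computable ps n"
    and f: "computable (fst # map (\<lambda>p. p \<circ> snd) ps) (\<lambda>e. f (fst e) (snd e))"
  shows "computable ps (\<lambda>e. \<Sum>i<n e. f i e)"
proof -
  note [computable] = computable_bound[OF f]
  have "(\<Sum>i<m. f i e) = rec_nat 0 (\<lambda>i y. y + f i e) m" for m e by (induction m) auto
  then show ?thesis by (simp only:) (intro computable)
qed

lemma computable_prod [computable]:
  assumes [computable]: "computable ps n"
    and f: "computable (fst # map (\<lambda>p. p \<circ> snd) ps) (\<lambda>e. f (fst e) (snd e))"
  shows "computable ps (\<lambda>e. \<Prod>i<n e. f i e)"
proof -
  note [computable] = computable_bound[OF f]
  have "(\<Prod>i<m. f i e) = rec_nat 1 (\<lambda>i y. y * f i e) m" for m e by (induction m) auto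
  then show ?thesis by (simp only:) (intro computable)
qed

text \<open>The range contains its upper bound, so it is never empty and the recursion can start
  from \<open>f 0 e\<close>.\<close>

lemma computable_Min [computable]:
  assumes [computable]: "computable ps n"
    and f: "computable (fst # map (\<lambda>p. p \<circ> snd) ps) (\<lambda>e. f (fst e) (snd e))"
  shows "computable ps (\<lambda>e. MIN i\<in>{..n e}. f i e)"
proof -
  note [computable] = computable_bound[OF f]
  have f0: "computable ps (\<lambda>e. f 0 e)"
    by (rule computable_instance[OF f, where k = "\<lambda>e. e"]) (auto intro: computable_var computable_const)
  have "(MIN i\<in>{..m}. f i e) = rec_nat (f 0 e) (\<lambda>i y. if y \<le> f (Suc i) e then y else f (Suc i) e) m" for m e
  proof (induction m)
    case (Suc m)
    have "(MIN i\<in>{..Suc m}. f i e) = min (f (Suc m) e) (MIN i\<in>{..m}. f i e)"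
      by (simp add: atMost_Suc)
    with Suc show ?case by (simp add: min_def)
  qed simp
  then show ?thesis by (simp only:) (intro computable f0)
qed

lemma computable_div [computable]:
  assumes [computable]: "computable ps f" "computable ps g" shows "computable ps (\<lambda>e. f e div g e)"
proof -
  \<comment> \<open>The quotient counts the positive multiples of \<open>y\<close> up to
    \<open>x\<close>, of which there are at most \<open>x\<close>. For \<open>y = 0\<close> every
    test would succeed, so that case is separate.\<close>
  have "x div y = (if y = 0 then 0 else \<Sum>k<x. if Suc k * y \<le> x then 1 else 0)" for x y :: nat
  proof (cases "y = 0")
    case False
    then have "{k. k < x \<and> Suc k * y \<le> x} = {..<x div y}"
      by (auto simp: less_eq_div_iff_mult_less_eq Suc_le_eq[symmetric] simp del: mult_Suc)
        (metis Suc_leD div_le_dividend le_trans less_eq_div_iff_mult_less_eq Suc_le_eq not_gr_zero)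
    then show ?thesis using False
      by (simp add: sum.If_cases lessThan_def Collect_conj_eq[symmetric])
  qed simp
  then show ?thesis by (simp only:) (intro computable)
qed

lemma computable_mod [computable]:
  assumes [computable]: "computable ps f" "computable ps g" shows "computable ps (\<lambda>e. f e mod g e)"
  unfolding minus_div_mult_eq_mod[symmetric] by (intro computable)

section \<open>Codes of pairs and lists\<close>

lemma computable_prod_encode [computable]:
  assumes [computable]: "computable ps f" "computable ps g"
  shows "computable ps (\<lambda>e. prod_encode (f e, g e))"
  unfolding prod_encode_def triangle_def case_prod_conv by (intro computable)

lemma computable_fst_prod_decode [computable]:
  assumes [computable]: "computable ps f" shows "computable ps (\<lambda>e. fst (prod_decode (f e)))"
proof -
  \<comment> \<open>Both components of a pair are at most its code, so decoding is a bounded search;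
    the sum has at most one nonzero summand.\<close>
  have "fst (prod_decode z) = (\<Sum>m<Suc z. \<Sum>n<Suc z. if prod_encode (m, n) = z then m else 0)" for z
  proof -
    obtain m n where mn: "prod_decode z = (m, n)" by (cases "prod_decode z")
    then have z: "z = prod_encode (m, n)" by (metis prod_decode_inverse)
    have "(\<Sum>m'<Suc z. \<Sum>n'<Suc z. if prod_encode (m', n') = z then m' else 0)
        = (\<Sum>m'<Suc z. if m' = m then m else 0)"
      using le_prod_encode_2[of n m]
      by (intro sum.cong) (auto simp: z if_distrib sum.delta less_Suc_eq_le)
    then show ?thesis using le_prod_encode_1[of m n] by (simp add: mn z less_Suc_eq_le del: sum.lessThan_Suc)
  qed
  then show ?thesis by (simp only:) (intro computable)
qed

lemma computable_snd_prod_decode [computable]: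
  assumes [computable]: "computable ps f" shows "computable ps (\<lambda>e. snd (prod_decode (f e)))"
proof -
  have snd_eq: "snd (prod_decode z) = (\<Sum>n<Suc z. if prod_encode (fst (prod_decode z), n) = z then n else 0)" for z
  proof -
    obtain m n where mn: "prod_decode z = (m, n)" by (cases "prod_decode z")
    then have z: "z = prod_encode (m, n)" by (metis prod_decode_inverse)
    show ?thesis using le_prod_encode_2[of n m]
      by (simp add: mn z less_Suc_eq_le if_distrib del: sum.lessThan_Suc)
  qed
  show ?thesis by (subst snd_eq) (intro computable)
qed

text \<open>\<open>list_encode\<close> codes a nonempty list as the successor of the pair of its
  head and the code of its tail; the recursion drops \<open>j\<close> heads.\<close>

definition code_nth :: "nat \<Rightarrow> nat \<Rightarrow> nat" where
  "code_nth t j = fst (prod_decode (rec_nat t (\<lambda>_ y. snd (prod_decode (y - 1))) j - 1))"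

lemma code_nth_list_encode: "j < length xs \<Longrightarrow> code_nth (list_encode xs) j = xs ! j"
proof -
  assume j: "j < length xs"
  have "rec_nat (list_encode xs) (\<lambda>_ y. snd (prod_decode (y - 1))) j = list_encode (drop j xs)" 
    using j
  proof (induction j)
    case (Suc j)
    then show ?case by (simp add: Cons_nth_drop_Suc[symmetric])
  qed simp
  then show ?thesis using j by (simp add: code_nth_def Cons_nth_drop_Suc[symmetric])
qed

lemma computable_code_nth [computable]:
  assumes [computable]: "computable ps f" "computable ps g"
  shows "computable ps (\<lambda>e. code_nth (f e) (g e))"
  unfolding code_nth_def by (intro computable)

section \<open>Bounds on reachability probabilities by expectations\<close>

definition expected :: "('s, 'a) mdp \<Rightarrow> 's \<Rightarrow> 'a \<Rightarrow> ('s \<Rightarrow> ennreal) \<Rightarrow> ennreal" where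
  "expected M s a f = (\<integral>\<^sup>+s'. ennreal (real_of_rat (mtrans M s a s')) * f s' \<partial>count_space (mstates M))"

text \<open>Tonelli exchanges the sum over states with the average over actions. A bound that holds
  for every enabled action thus carries over to randomised choices.\<close>

lemma nn_integral_step_kernel:
  assumes M: "mdp M" and \<sigma>: "\<sigma> \<in> schedulers M" and \<omega>: "\<And>k. k \<le> i \<Longrightarrow> \<omega> k \<in> mstates M"
    and en: "enabled M (\<omega> i) \<noteq> {}"
  shows "(\<integral>\<^sup>+x. f x \<partial>step_kernel M \<sigma> s0 (Suc i) \<omega>)
    = (\<integral>\<^sup>+a. expected M (\<omega> i) a f \<partial>measure_pmf (\<sigma> (map \<omega> [0..<Suc i])))"
    and "set_pmf (\<sigma> (map \<omega> [0..<Suc i])) \<subseteq> enabled M (\<omega> i)"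
proof -
  let ?S = "mstates M" and ?s = "\<omega> i"
  define h where "h = map \<omega> [0..<Suc i]"
  let ?p = "\<lambda>a s'. real_of_rat (mtrans M ?s a s')"
  have S: "countable ?S" using M by (simp add: mdp_def)
  have "h \<noteq> []" "set h \<subseteq> ?S" "last h = ?s"
    using \<omega> by (auto simp: h_def last_map)
  with \<sigma> en have sub: "set_pmf (\<sigma> h) \<subseteq> enabled M ?s"
    unfolding schedulers_def by fastforce
  then show "set_pmf (\<sigma> (map \<omega> [0..<Suc i])) \<subseteq> enabled M (\<omega> i)" by (simp only: h_def)
  have p: "0 \<le> ?p a s'" "?p a s' \<le> 1" if "a \<in> set_pmf (\<sigma> h)" "s' \<in> ?S" for a s'
    using M \<omega>[of i] sub that by (auto simp: mdp_def enabled_def)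
  have eq: "ennreal (\<integral>a. ?p a s' \<partial>measure_pmf (\<sigma> h)) = (\<integral>\<^sup>+a. ennreal (?p a s') \<partial>measure_pmf (\<sigma> h))"
    if "s' \<in> ?S" for s'
    using p that
    by (intro nn_integral_eq_integral[symmetric] measure_pmf.integrable_const_bound[where B = 1])
       (auto intro!: AE_pmfI)
  have "step_kernel M \<sigma> s0 (Suc i) \<omega> = point_measure ?S (\<lambda>s'. ennreal (\<integral>a. ?p a s' \<partial>measure_pmf (\<sigma> h)))"
    using en by (simp add: step_kernel_def h_def)
  then have "(\<integral>\<^sup>+x. f x \<partial>step_kernel M \<sigma> s0 (Suc i) \<omega>)
      = (\<integral>\<^sup>+s'. ennreal (\<integral>a. ?p a s' \<partial>measure_pmf (\<sigma> h)) * f s' \<partial>count_space ?S)"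
    by (simp add: point_measure_def nn_integral_density)
  also have "\<dots> = (\<integral>\<^sup>+s'. (\<integral>\<^sup>+a. ennreal (?p a s') * f s' \<partial>measure_pmf (\<sigma> h)) \<partial>count_space ?S)"
    by (intro nn_integral_cong) (simp add: eq nn_integral_multc)
  also have "\<dots> = (\<integral>\<^sup>+a. expected M ?s a f \<partial>measure_pmf (\<sigma> h))"
    unfolding expected_def using S by (intro nn_integral_count_space_nn_integral[symmetric]) auto
  finally show "(\<integral>\<^sup>+x. f x \<partial>step_kernel M \<sigma> s0 (Suc i) \<omega>)
    = (\<integral>\<^sup>+a. expected M (\<omega> i) a f \<partial>measure_pmf (\<sigma> (map \<omega> [0..<Suc i])))"
    by (simp only: h_def)
qed

section \<open>Laws of path prefixes and martingale bounds\<close>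

locale mdp_paths =
  fixes M :: "('s, 'a) mdp" and \<sigma> :: "'s list \<Rightarrow> 'a pmf" and s0 :: 's
  assumes M: "mdp M" and \<sigma>: "\<sigma> \<in> schedulers M" and s0: "s0 \<in> mstates M"
begin

sublocale IT: Ionescu_Tulcea "step_kernel M \<sigma> s0" "\<lambda>_. count_space (mstates M)"
  using M \<sigma> s0 by (rule Ionescu_Tulcea_step_kernel)

text \<open>The law of the states at times \<open>0\<close> to \<open>n - 1\<close>, built from the
  empty prefix by composing the kernels.\<close>

definition prefix_dist :: "nat \<Rightarrow> (nat \<Rightarrow> 's) measure" where
  "prefix_dist n = IT.C 0 n (\<lambda>_. undefined)"

lemma countable_states: "countable (mstates M)"
  using M by (simp add: mdp_def)

lemma PiM_prefix:
  "PiM {0..<n::nat} (\<lambda>_. count_space (mstates M)) = count_space ({0..<n} \<rightarrow>\<^sub>E mstates M)"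
  by (rule count_space_PiM_finite) (auto simp: countable_states)

lemma space_prefix: "space (prefix_dist n) = {0..<n} \<rightarrow>\<^sub>E mstates M"
  unfolding prefix_dist_def by (subst IT.space_C) (auto simp: PiM_prefix simp del: PiM_empty)

lemma sets_prefix: "sets (prefix_dist n) = Pow ({0..<n} \<rightarrow>\<^sub>E mstates M)"
  unfolding prefix_dist_def by (subst IT.sets_C) (auto simp: PiM_prefix simp del: PiM_empty)

text \<open>Countably many states make every space of prefixes discrete, so that each function
  \<open>f\<close> is measurable and can be integrated over the last state first.\<close>

lemma nn_integral_prefix_Suc:
  "(\<integral>\<^sup>+\<omega>. f \<omega> \<partial>prefix_dist (Suc n)) = (\<integral>\<^sup>+\<omega>. (\<integral>\<^sup>+x. f (fun_upd \<omega> n x) \<partial>step_kernel M \<sigma> s0 n \<omega>) \<partial>prefix_dist n)"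
proof -
  have "(\<integral>\<^sup>+\<omega>. f \<omega> \<partial>prefix_dist (Suc n)) = (\<integral>\<^sup>+\<omega>. (\<integral>\<^sup>+y. f y \<partial>IT.eP n \<omega>) \<partial>prefix_dist n)"
    unfolding prefix_dist_def IT.C.simps
  proof (subst nn_integral_bind)
    show "f \<in> borel_measurable (PiM {0..<Suc n} (\<lambda>_. count_space (mstates M)))"
      by (subst PiM_prefix) simp
    show "IT.eP (0 + n) \<in> IT.C 0 n (\<lambda>_. undefined) \<rightarrow>\<^sub>M
        subprob_algebra (PiM {0..<Suc n} (\<lambda>_. count_space (mstates M)))"
      using IT.measurable_eP[of n] by (simp add: measurable_cong_sets[OF IT.sets_C refl])
  qed simp
  also have "\<dots> = (\<integral>\<^sup>+\<omega>. (\<integral>\<^sup>+x. f (fun_upd \<omega> n x) \<partial>step_kernel M \<sigma> s0 n \<omega>) \<partial>prefix_dist n)"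
    by (intro nn_integral_cong IT.nn_integral_eP) (auto simp: space_prefix PiM_prefix)
  finally show ?thesis .
qed

lemma nn_integral_prefix_1: "(\<integral>\<^sup>+\<omega>. f \<omega> \<partial>prefix_dist (Suc 0)) = f (fun_upd (\<lambda>_. undefined) 0 s0)"
proof -
  have "(\<integral>\<^sup>+x. f (fun_upd \<omega> 0 x) \<partial>step_kernel M \<sigma> s0 0 \<omega>) = f (fun_upd \<omega> 0 s0)" for \<omega>
    using s0 by (simp add: step_kernel_def nn_integral_return)
  then show ?thesis
    unfolding nn_integral_prefix_Suc
    using PiM_prefix[of 0] by (simp add: prefix_dist_def) (subst nn_integral_return, auto)
qed

lemma emeasure_path_measure_prefix:
  "emeasure (path_measure M \<sigma> s0) {\<omega> \<in> UNIV \<rightarrow>\<^sub>E mstates M. R (restrict \<omega> {0..<n})}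
    = emeasure (prefix_dist n) {\<omega> \<in> {0..<n} \<rightarrow>\<^sub>E mstates M. R \<omega>}"
proof -
  let ?X = "{\<omega> \<in> {0..<n} \<rightarrow>\<^sub>E mstates M. R \<omega>}"
  have X: "?X \<in> sets (PiM {0..<n} (\<lambda>_. count_space (mstates M)))" by (auto simp: PiM_prefix)
  have "emeasure (path_measure M \<sigma> s0) (IT.PF.emb UNIV {0..<n} ?X) = emeasure (IT.CI {0..<n}) ?X"
    unfolding path_measure_def by (rule IT.lim) (use X in auto)
  also have "\<dots> = emeasure (prefix_dist n) (IT.PF.emb {0..<n} {0..<n} ?X)"
    unfolding prefix_dist_def by (rule IT.emeasure_CI) (use X in auto)
  also have "IT.PF.emb {0..<n} {0..<n} ?X = ?X"
    by (auto simp: prod_emb_def space_PiM PiE_restrict)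
  also have "IT.PF.emb UNIV {0..<n} ?X = {\<omega> \<in> UNIV \<rightarrow>\<^sub>E mstates M. R (restrict \<omega> {0..<n})}"
    by (auto simp: prod_emb_def PiE_iff space_PiM)
  finally show ?thesis .
qed

lemma sets_path_measure_eventually: "eventually_in M G \<in> sets (path_measure M \<sigma> s0)"
  using eventually_in_measurable[of M G] prob_space_path_measure(2)[OF M \<sigma> s0] by simp

text \<open>The remaining horizon shrinks by one with each step; at time \<open>n\<close> only
  \<open>f 0\<close> is left, which lies below the indicator of \<open>G\<close>. The assumption
  \<open>dead\<close> covers states that are repeated for lack of actions.\<close>

lemma submartingale_le_reach:
  assumes f0: "\<And>s. s \<in> mstates M \<Longrightarrow> f 0 s \<le> indicator G s"
    and step: "\<And>m s a. s \<in> mstates M \<Longrightarrow> a \<in> enabled M s \<Longrightarrow> f (Suc m) s \<le> expected M s a (f m)"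
    and dead: "\<And>m s. s \<in> mstates M \<Longrightarrow> enabled M s = {} \<Longrightarrow> f (Suc m) s \<le> f m s"
  shows "f n s0 \<le> emeasure (path_measure M \<sigma> s0) (eventually_in M G)"
proof -
  \<comment> \<open>A prefix of length \<open>Suc j\<close> ends with the state at time
    \<open>j\<close>.\<close>
  have "f n s0 \<le> (\<integral>\<^sup>+\<omega>. f (n - j) (\<omega> j) \<partial>prefix_dist (Suc j))" if "j \<le> n" for j
    using that
  proof (induction j)
    case 0
    then show ?case by (simp add: nn_integral_prefix_1)
  next
    case (Suc j)
    then have "f n s0 \<le> (\<integral>\<^sup>+\<omega>. f (n - j) (\<omega> j) \<partial>prefix_dist (Suc j))" by simp
    also have "\<dots> \<le> (\<integral>\<^sup>+\<omega>. (\<integral>\<^sup>+x. f (n - Suc j) x \<partial>step_kernel M \<sigma> s0 (Suc j) \<omega>) \<partial>prefix_dist (Suc j))"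
    proof (rule nn_integral_mono)
      fix \<omega> assume "\<omega> \<in> space (prefix_dist (Suc j))"
      then have \<omega>: "\<omega> k \<in> mstates M" if "k \<le> j" for k
        using that by (auto simp: space_prefix PiE_iff)
      have n: "n - j = Suc (n - Suc j)" using Suc.prems by simp
      show "f (n - j) (\<omega> j) \<le> (\<integral>\<^sup>+x. f (n - Suc j) x \<partial>step_kernel M \<sigma> s0 (Suc j) \<omega>)"
      proof (cases "enabled M (\<omega> j) = {}")
        case True
        then show ?thesis using \<omega>[of j] dead[of "\<omega> j"]
          by (simp add: step_kernel_def nn_integral_return n)
      next
        case False
        let ?p = "measure_pmf (\<sigma> (map \<omega> [0..<Suc j]))"
        have "f (n - j) (\<omega> j) = (\<integral>\<^sup>+a. f (n - j) (\<omega> j) \<partial>?p)"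
          by (simp add: measure_pmf.emeasure_space_1[simplified])
        also have "\<dots> \<le> (\<integral>\<^sup>+a. expected M (\<omega> j) a (f (n - Suc j)) \<partial>?p)"
          using nn_integral_step_kernel(2)[where i = j and \<omega> = \<omega>, OF M \<sigma> \<omega> False] step \<omega>[of j]
          by (intro nn_integral_mono_AE AE_pmfI) (auto simp: n)
        finally show ?thesis using nn_integral_step_kernel(1)[where i = j and \<omega> = \<omega>, OF M \<sigma> \<omega> False] by simp
      qed
    qed
    also have "\<dots> = (\<integral>\<^sup>+\<omega>. f (n - Suc j) (\<omega> (Suc j)) \<partial>prefix_dist (Suc (Suc j)))"
      by (subst (2) nn_integral_prefix_Suc) simp
    finally show ?case .
  qed
  from this[of n] have "f n s0 \<le> (\<integral>\<^sup>+\<omega>. f 0 (\<omega> n) \<partial>prefix_dist (Suc n))" by simp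
  also have "\<dots> \<le> (\<integral>\<^sup>+\<omega>. indicator {\<omega> \<in> {0..<Suc n} \<rightarrow>\<^sub>E mstates M. \<omega> n \<in> G} \<omega> \<partial>prefix_dist (Suc n))"
    using f0[of "\<omega> n" for \<omega>]
    by (intro nn_integral_mono) (force simp: space_prefix PiE_iff indicator_def)
  also have "\<dots> = emeasure (prefix_dist (Suc n)) {\<omega> \<in> {0..<Suc n} \<rightarrow>\<^sub>E mstates M. \<omega> n \<in> G}"
    by (rule nn_integral_indicator) (auto simp: sets_prefix)
  also have "\<dots> = emeasure (path_measure M \<sigma> s0)
      {\<omega> \<in> UNIV \<rightarrow>\<^sub>E mstates M. restrict \<omega> {0..<Suc n} n \<in> G}"
    by (rule emeasure_path_measure_prefix[symmetric])
  also have "\<dots> \<le> emeasure (path_measure M \<sigma> s0) (eventually_in M G)"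
    by (intro emeasure_mono sets_path_measure_eventually) (auto simp: eventually_in_def space_PiM)
  finally show ?thesis .
qed

text \<open>The step condition concerns only the actions that \<open>\<sigma>\<close> plays, so it
  can be met by one well-chosen scheduler.\<close>

lemma reach_le_supermartingale:
  assumes G: "\<And>s. s \<in> mstates M \<Longrightarrow> s \<in> G \<Longrightarrow> 1 \<le> v s"
    and step: "\<And>h a. h \<noteq> [] \<Longrightarrow> set h \<subseteq> mstates M \<Longrightarrow> enabled M (last h) \<noteq> {} \<Longrightarrow> a \<in> set_pmf (\<sigma> h) \<Longrightarrow>
      expected M (last h) a v \<le> v (last h)"
  shows "emeasure (path_measure M \<sigma> s0) (eventually_in M G) \<le> v s0"
proof -
  \<comment> \<open>After a visit to \<open>G\<close> the process is frozen at 1, since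
    \<open>v\<close> may fall below 1 once \<open>G\<close> is left. Its mean then bounds the
    probability of a visit by time \<open>j\<close>.\<close>
  let ?Y = "\<lambda>j \<omega>. if \<exists>k\<le>j. \<omega> k \<in> G then 1 else v (\<omega> j) :: ennreal"
  have Y: "(\<integral>\<^sup>+\<omega>. ?Y j \<omega> \<partial>prefix_dist (Suc j)) \<le> v s0" for j
  proof (induction j)
    case 0
    then show ?case using G[OF s0] by (simp add: nn_integral_prefix_1)
  next
    case (Suc j)
    have "(\<integral>\<^sup>+\<omega>. ?Y (Suc j) \<omega> \<partial>prefix_dist (Suc (Suc j)))
      = (\<integral>\<^sup>+\<omega>. (\<integral>\<^sup>+x. ?Y (Suc j) (fun_upd \<omega> (Suc j) x) \<partial>step_kernel M \<sigma> s0 (Suc j) \<omega>) \<partial>prefix_dist (Suc j))"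
      by (rule nn_integral_prefix_Suc)
    also have "\<dots> \<le> (\<integral>\<^sup>+\<omega>. ?Y j \<omega> \<partial>prefix_dist (Suc j))"
    proof (rule nn_integral_mono)
      fix \<omega> assume sp: "\<omega> \<in> space (prefix_dist (Suc j))"
      then have \<omega>: "\<omega> k \<in> mstates M" if "k \<le> j" for k
        using that by (auto simp: space_prefix PiE_iff)
      let ?K = "step_kernel M \<sigma> s0 (Suc j) \<omega>"
      have \<omega>S: "\<omega> \<in> space (PiM {0..<Suc j} (\<lambda>_. count_space (mstates M)))"
        using sp by (simp add: space_prefix PiM_prefix)
      interpret K: prob_space ?K by (rule IT.prob_space_P[OF \<omega>S])
      have spK: "space ?K = mstates M" using IT.space_P[OF \<omega>S] by simp
      show "(\<integral>\<^sup>+x. ?Y (Suc j) (fun_upd \<omega> (Suc j) x) \<partial>?K) \<le> ?Y j \<omega>"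
      proof (cases "\<exists>k\<le>j. \<omega> k \<in> G")
        case True
        then have "\<exists>k\<le>Suc j. (fun_upd \<omega> (Suc j) x) k \<in> G" for x
          by (metis fun_upd_other le_Suc_eq not_less_eq_eq)
        then show ?thesis using True K.emeasure_space_1 by simp
      next
        case False
        then have *: "(\<exists>k\<le>Suc j. (fun_upd \<omega> (Suc j) x) k \<in> G) \<longleftrightarrow> x \<in> G" for x
          by (auto simp: le_Suc_eq)
        have "(\<integral>\<^sup>+x. ?Y (Suc j) (fun_upd \<omega> (Suc j) x) \<partial>?K) \<le> (\<integral>\<^sup>+x. v x \<partial>?K)"
          unfolding * using G by (intro nn_integral_mono) (auto simp: spK)
        also have "\<dots> \<le> v (\<omega> j)"
        proof (cases "enabled M (\<omega> j) = {}")
          case True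
          then show ?thesis using \<omega>[of j] by (simp add: step_kernel_def nn_integral_return)
        next
          case en: False
          let ?h = "map \<omega> [0..<Suc j]"
          have last: "?h \<noteq> []" "last ?h = \<omega> j" "set ?h \<subseteq> mstates M" using \<omega> by (auto simp: last_map)
          have "(\<integral>\<^sup>+x. v x \<partial>?K) = (\<integral>\<^sup>+a. expected M (\<omega> j) a v \<partial>measure_pmf (\<sigma> ?h))"
            by (rule nn_integral_step_kernel(1)[where i = j and \<omega> = \<omega>, OF M \<sigma> \<omega> en])
          also have "\<dots> \<le> (\<integral>\<^sup>+a. v (\<omega> j) \<partial>measure_pmf (\<sigma> ?h))"
            using step[OF last(1,3)] en unfolding last(2)
            by (intro nn_integral_mono_AE AE_pmfI) auto
          also have "\<dots> = v (\<omega> j)" by (simp add: measure_pmf.emeasure_space_1[simplified])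
          finally show ?thesis .
        qed
        finally show ?thesis unfolding if_not_P[OF False] .
      qed
    qed
    finally show ?case using Suc.IH by simp
  qed
  define H where "H j = {\<omega> \<in> UNIV \<rightarrow>\<^sub>E mstates M. \<exists>k\<le>j. restrict \<omega> {0..<Suc j} k \<in> G}" for j
  have H_iff: "\<omega> \<in> H j \<longleftrightarrow> \<omega> \<in> UNIV \<rightarrow>\<^sub>E mstates M \<and> (\<exists>k\<le>j. \<omega> k \<in> G)" for \<omega> j
    by (simp add: H_def less_Suc_eq_le cong: conj_cong)
  have Hle: "emeasure (path_measure M \<sigma> s0) (H j) \<le> v s0" for j
  proof -
    let ?X = "{\<omega> \<in> {0..<Suc j} \<rightarrow>\<^sub>E mstates M. \<exists>k\<le>j. \<omega> k \<in> G}"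
    have "emeasure (path_measure M \<sigma> s0) (H j) = emeasure (prefix_dist (Suc j)) ?X"
      unfolding H_def by (rule emeasure_path_measure_prefix)
    also have "\<dots> = (\<integral>\<^sup>+\<omega>. indicator ?X \<omega> \<partial>prefix_dist (Suc j))"
      by (rule nn_integral_indicator[symmetric]) (auto simp: sets_prefix)
    also have "\<dots> \<le> (\<integral>\<^sup>+\<omega>. ?Y j \<omega> \<partial>prefix_dist (Suc j))"
      by (intro nn_integral_mono) (auto split: split_indicator)
    finally show ?thesis using Y[of j] by simp
  qed
  have H_meas: "H j \<in> sets (path_measure M \<sigma> s0)" for j
  proof -
    have "H j = (\<Union>k\<in>{..j}.
      (\<lambda>\<omega>. \<omega> k) -` (G \<inter> mstates M) \<inter> space (PiM UNIV (\<lambda>_. count_space (mstates M))))"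
      by (auto simp: H_iff space_PiM PiE_iff)
    also have "\<dots> \<in> sets (PiM UNIV (\<lambda>_. count_space (mstates M)))"
      by (intro sets.finite_UN
          measurable_sets[OF measurable_component_singleton[where M = "\<lambda>_. count_space (mstates M)"]])
        simp_all
    finally show ?thesis using prob_space_path_measure(2)[OF M \<sigma> s0] by simp
  qed
  have incH: "incseq H"
    by (rule incseq_SucI) (auto simp: H_iff le_Suc_eq)
  \<comment> \<open>The visits up to time \<open>j\<close> increase to the whole event, and
    continuity from below carries the bound over.\<close>
  have "eventually_in M G = (\<Union>j. H j)"
  proof (rule set_eqI)
    fix \<omega>
    show "\<omega> \<in> eventually_in M G \<longleftrightarrow> \<omega> \<in> (\<Union>j. H j)"
      unfolding UN_iff H_iff eventually_in_def space_PiM space_count_space mem_Collect_eq by auto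
  qed
  then have "emeasure (path_measure M \<sigma> s0) (eventually_in M G) = (SUP j. emeasure (path_measure M \<sigma> s0) (H j))"
    using SUP_emeasure_incseq[of H "path_measure M \<sigma> s0"] H_meas incH
    by (simp add: image_subset_iff)
  also have "\<dots> \<le> v s0" by (intro SUP_least Hle)
  finally show ?thesis .
qed

end

lemma inf_reach_ge:
  assumes M: "mdp M" and s0: "s0 \<in> mstates M"
    and f0: "\<And>s. s \<in> mstates M \<Longrightarrow> f 0 s \<le> indicator G s"
    and step: "\<And>m s a. s \<in> mstates M \<Longrightarrow> a \<in> enabled M s \<Longrightarrow> f (Suc m) s \<le> expected M s a (f m)"
    and dead: "\<And>m s. s \<in> mstates M \<Longrightarrow> enabled M s = {} \<Longrightarrow> f (Suc m) s \<le> f m s"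
  shows "f n s0 \<le> ennreal (inf_reach M s0 G)"
proof -
  have *: "f n s0 \<le> ennreal (measure (path_measure M \<sigma> s0) (eventually_in M G))"
    if \<sigma>: "\<sigma> \<in> schedulers M" for \<sigma>
  proof -
    interpret mdp_paths M \<sigma> s0 by unfold_locales fact+
    interpret prob_space "path_measure M \<sigma> s0" by (rule prob_space_path_measure(1)[OF M \<sigma> s0])
    have "f n s0 \<le> emeasure (path_measure M \<sigma> s0) (eventually_in M G)"
      by (rule submartingale_le_reach[where f = f]) (fact f0 step dead)+
    then show ?thesis by (simp add: emeasure_eq_measure)
  qed
  \<comment> \<open>A single scheduler already shows that \<open>f n s0\<close> is finite, so the
    comparison can move to the reals, where the infimum is taken.\<close>
  obtain \<sigma> where "\<sigma> \<in> schedulers M" using schedulers_nonempty by blast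
  from *[OF this] obtain c where c: "0 \<le> c" "f n s0 = ennreal c"
    by (metis ennreal_cases ennreal_neq_top top.extremum_unique)
  have "c \<le> inf_reach M s0 G"
    unfolding inf_reach_def using * c by (intro cINF_greatest schedulers_nonempty) auto
  then show ?thesis unfolding c(2) by (rule ennreal_leI)
qed

text \<open>The witness is memoryless and deterministic: from the last state alone it picks an
  action that does not raise \<open>v\<close> in expectation.\<close>

lemma inf_reach_le:
  assumes M: "mdp M" and s0: "s0 \<in> mstates M"
    and G: "\<And>s. s \<in> mstates M \<Longrightarrow> s \<in> G \<Longrightarrow> 1 \<le> v s"
    and step: "\<And>s. s \<in> mstates M \<Longrightarrow> enabled M s \<noteq> {} \<Longrightarrow> \<exists>a\<in>enabled M s. expected M s a v \<le> v s"
  shows "ennreal (inf_reach M s0 G) \<le> v s0"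
proof -
  define act where "act s = (SOME a. a \<in> enabled M s \<and> expected M s a v \<le> v s)" for s
  have act: "act s \<in> enabled M s \<and> expected M s (act s) v \<le> v s"
    if "s \<in> mstates M" "enabled M s \<noteq> {}" for s
    unfolding act_def by (rule someI_ex) (use step[OF that] in blast)
  define \<sigma> where "\<sigma> h = return_pmf (act (last h))" for h
  have \<sigma>: "\<sigma> \<in> schedulers M"
    unfolding schedulers_def \<sigma>_def using act by (auto simp: subset_iff)
  interpret mdp_paths M \<sigma> s0 by unfold_locales fact+
  interpret prob_space "path_measure M \<sigma> s0" by (rule prob_space_path_measure(1)[OF M \<sigma> s0])
  have "emeasure (path_measure M \<sigma> s0) (eventually_in M G) \<le> v s0"
  proof (rule reach_le_supermartingale[OF G])
    fix h a assume "h \<noteq> []" "set h \<subseteq> mstates M" "enabled M (last h) \<noteq> {}" "a \<in> set_pmf (\<sigma> h)"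
    then show "expected M (last h) a v \<le> v (last h)" using act[OF subsetD[OF _ last_in_set]] by (simp add: \<sigma>_def)
  qed auto
  moreover have "inf_reach M s0 G \<le> measure (path_measure M \<sigma> s0) (eventually_in M G)"
    unfolding inf_reach_def by (rule cINF_lower[OF _ \<sigma>]) (auto intro: bdd_belowI[of _ 0])
  ultimately show ?thesis by (metis emeasure_eq_measure ennreal_leI order_trans)
qed

section \<open>Finite-horizon values of a POMDP\<close>

text \<open>The belief update before normalisation; the mass of the result is the weight with which
  \<open>s\<close> is emitted.\<close>

definition push :: "('q, 'a, 'o) pomdp \<Rightarrow> ('q \<Rightarrow> real) \<Rightarrow> 'a \<Rightarrow> 'o \<Rightarrow> 'q \<Rightarrow> real" where
  "push P \<alpha> a s q' = (\<Sum>q\<in>pstates P. \<alpha> q * real_of_rat (ptrans P q a s q'))"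

primrec val :: "('q, 'a, 'o) pomdp \<Rightarrow> nat \<Rightarrow> ('q \<Rightarrow> real) \<Rightarrow> real" where
  "val P 0 \<alpha> = \<alpha> (pgoal P)"
| "val P (Suc n) \<alpha> = (MIN a\<in>pactions P. \<Sum>s\<in>psignals P. val P n (push P \<alpha> a s))"

definition lval :: "('q, 'a, 'o) pomdp \<Rightarrow> ('q \<Rightarrow> real) \<Rightarrow> real" where
  "lval P \<alpha> = (SUP n. val P n \<alpha>)"

text \<open>Without actions the minimum in \<open>val\<close> would range over the empty set;
  \<open>inf_reach_no_actions\<close> covers that case.\<close>

locale pomdp_model =
  fixes P :: "('q, 'a, 'o) pomdp"
  assumes P: "pomdp P" and acts: "pactions P \<noteq> {}"
begin

abbreviation "Q \<equiv> pstates P"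
abbreviation "A \<equiv> pactions P"
abbreviation "S \<equiv> psignals P"
abbreviation "g \<equiv> pgoal P"
abbreviation "pr q a s q' \<equiv> real_of_rat (ptrans P q a s q')"

definition nonneg_vec :: "('q \<Rightarrow> real) \<Rightarrow> bool" where
  "nonneg_vec \<alpha> \<longleftrightarrow> (\<forall>q\<in>Q. 0 \<le> \<alpha> q)"

definition mass :: "('q \<Rightarrow> real) \<Rightarrow> real" where
  "mass \<alpha> = (\<Sum>q\<in>Q. \<alpha> q)"

text \<open>With such a vector it is known whether the goal has been reached; see
  \<open>belief_eq_goal\<close>.\<close>

definition consistent :: "('q \<Rightarrow> real) \<Rightarrow> bool" where
  "consistent \<alpha> \<longleftrightarrow> \<alpha> g = 0 \<or> (\<forall>q\<in>Q - {g}. \<alpha> q = 0)"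

lemma fin [simp]: "finite Q" "finite A" "finite S" and gQ [simp]: "g \<in> Q"
  using P by (auto simp: pomdp_def)

lemma ptrans_nonneg [simp]:
  "q \<in> Q \<Longrightarrow> a \<in> A \<Longrightarrow> s \<in> S \<Longrightarrow> q' \<in> Q \<Longrightarrow> 0 \<le> ptrans P q a s q'"
  using P by (auto simp: pomdp_def)

lemma pr_sum: "q \<in> Q \<Longrightarrow> a \<in> A \<Longrightarrow> (\<Sum>s\<in>S. \<Sum>q'\<in>Q. pr q a s q') = 1"
  using P by (auto simp: pomdp_def simp flip: of_rat_sum)

lemma push_cong: "(\<And>q. q \<in> Q \<Longrightarrow> \<alpha> q = \<beta> q) \<Longrightarrow> push P \<alpha> a s = push P \<beta> a s"
  by (auto simp: push_def fun_eq_iff)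

lemma val_cong: "(\<And>q. q \<in> Q \<Longrightarrow> \<alpha> q = \<beta> q) \<Longrightarrow> val P n \<alpha> = val P n \<beta>"
  by (cases n) (simp_all cong: push_cong add: push_cong[of \<alpha> \<beta>])

lemma push_scale: "push P (\<lambda>q. c * \<alpha> q) a s = (\<lambda>q. c * push P \<alpha> a s q)"
  by (simp add: push_def sum_distrib_left mult.assoc fun_eq_iff)

lemma push_add: "push P (\<lambda>q. \<alpha> q + \<beta> q) a s = (\<lambda>q. push P \<alpha> a s q + push P \<beta> a s q)"
  by (simp add: push_def sum.distrib distrib_right fun_eq_iff)

lemma push_mono:
  "(\<And>q. q \<in> Q \<Longrightarrow> \<alpha> q \<le> \<beta> q) \<Longrightarrow> a \<in> A \<Longrightarrow> s \<in> S \<Longrightarrow> q' \<in> Q \<Longrightarrow> push P \<alpha> a s q' \<le> push P \<beta> a s q'"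
  unfolding push_def by (intro sum_mono mult_right_mono) auto

lemma nonneg_push: "nonneg_vec \<alpha> \<Longrightarrow> a \<in> A \<Longrightarrow> s \<in> S \<Longrightarrow> nonneg_vec (push P \<alpha> a s)"
  unfolding nonneg_vec_def push_def by (auto intro!: sum_nonneg)

lemma mass_push: 
  assumes "a \<in> A" shows "(\<Sum>s\<in>S. mass (push P \<alpha> a s)) = mass \<alpha>"
proof -
  have "(\<Sum>s\<in>S. mass (push P \<alpha> a s)) = (\<Sum>s\<in>S. \<Sum>q\<in>Q. \<Sum>q'\<in>Q. \<alpha> q * pr q a s q')"
    unfolding mass_def push_def by (intro sum.cong refl sum.swap)
  also have "\<dots> = (\<Sum>q\<in>Q. \<alpha> q * (\<Sum>s\<in>S. \<Sum>q'\<in>Q. pr q a s q'))"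
    by (subst sum.swap) (simp add: sum_distrib_left)
  also have "\<dots> = mass \<alpha>" using assms by (simp add: pr_sum mass_def)
  finally show ?thesis .
qed

text \<open>The goal signal leads only to the goal and every other signal only elsewhere, so one
  observation settles the question, whatever \<alpha> was.\<close>

lemma consistent_push:
  assumes "a \<in> A" "s \<in> S" shows "consistent (push P \<alpha> a s)"
proof (cases "s = pgoal_signal P")
  case True
  have "pr q a s q' = 0" if "q \<in> Q" "q' \<in> Q - {g}" for q q'
  proof -
    have "\<not> ptrans P q a s q' > 0" "0 \<le> ptrans P q a s q'"
      using P assms that True unfolding pomdp_def by blast+
    then show ?thesis by simp
  qed
  then show ?thesis unfolding consistent_def push_def by auto
next
  case False
  have "pr q a s g = 0" if "q \<in> Q" for q
  proof -
    have "\<not> ptrans P q a s g > 0" "0 \<le> ptrans P q a s g"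
      using P assms that False unfolding pomdp_def by blast+
    then show ?thesis by simp
  qed
  then show ?thesis unfolding consistent_def push_def by auto
qed

lemma val_Suc_le: "a \<in> A \<Longrightarrow> val P (Suc n) \<alpha> \<le> (\<Sum>s\<in>S. val P n (push P \<alpha> a s))"
  by simp

lemma val_Suc_attained: obtains a where "a \<in> A" "val P (Suc n) \<alpha> = (\<Sum>s\<in>S. val P n (push P \<alpha> a s))"
proof -
  have "val P (Suc n) \<alpha> \<in> (\<lambda>a. \<Sum>s\<in>S. val P n (push P \<alpha> a s)) ` A"
    using acts by (subst val.simps, intro Min_in) auto
  then show thesis using that by blast
qed

lemma val_mono: "(\<And>q. q \<in> Q \<Longrightarrow> \<alpha> q \<le> \<beta> q) \<Longrightarrow> val P n \<alpha> \<le> val P n \<beta>"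
proof (induction n arbitrary: \<alpha> \<beta>)
  case (Suc n)
  obtain a where a: "a \<in> A" "val P (Suc n) \<beta> = (\<Sum>s\<in>S. val P n (push P \<beta> a s))"
    by (rule val_Suc_attained)
  have "val P (Suc n) \<alpha> \<le> (\<Sum>s\<in>S. val P n (push P \<alpha> a s))" using a(1) by (rule val_Suc_le)
  also have "\<dots> \<le> val P (Suc n) \<beta>"
    unfolding a(2) using Suc a(1) by (intro sum_mono Suc.IH push_mono) auto
  finally show ?case .
qed simp

lemma val_scale: "0 \<le> c \<Longrightarrow> val P n (\<lambda>q. c * \<alpha> q) = c * val P n \<alpha>"
proof (induction n arbitrary: \<alpha>)
  case (Suc n)
  have "mono ((*) c)" using Suc.prems by (simp add: mono_def mult_left_mono)
  from mono_Min_commute[OF this, of "(\<lambda>a. \<Sum>s\<in>S. val P n (push P \<alpha> a s)) ` A"] show ?case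
    using acts Suc by (simp add: push_scale sum_distrib_left image_image)
qed simp

lemma val_zero: "val P n (\<lambda>_. 0) = 0"
  using val_scale[of 0 n "\<lambda>_. 0"] by simp

lemma val_nonneg: "nonneg_vec \<alpha> \<Longrightarrow> 0 \<le> val P n \<alpha>"
  using val_mono[of "\<lambda>_. 0" \<alpha> n] by (simp add: val_zero nonneg_vec_def)

lemma mass_nonneg: "nonneg_vec \<alpha> \<Longrightarrow> 0 \<le> mass \<alpha>"
  unfolding nonneg_vec_def mass_def by (intro sum_nonneg) auto

lemma le_mass: "nonneg_vec \<alpha> \<Longrightarrow> q \<in> Q \<Longrightarrow> \<alpha> q \<le> mass \<alpha>"
  unfolding nonneg_vec_def mass_def by (intro member_le_sum) auto

text \<open>Keep to the actions that are optimal for \<alpha>: then \<beta> contributes at most its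
  mass, whose total over the signals \<open>push\<close> preserves.\<close>

lemma val_add: "nonneg_vec \<beta> \<Longrightarrow> val P n (\<lambda>q. \<alpha> q + \<beta> q) \<le> val P n \<alpha> + mass \<beta>"
proof (induction n arbitrary: \<alpha> \<beta>)
  case (Suc n)
  obtain a where a: "a \<in> A" "val P (Suc n) \<alpha> = (\<Sum>s\<in>S. val P n (push P \<alpha> a s))"
    by (rule val_Suc_attained)
  have "val P (Suc n) (\<lambda>q. \<alpha> q + \<beta> q) \<le> (\<Sum>s\<in>S. val P n (\<lambda>q. push P \<alpha> a s q + push P \<beta> a s q))"
    using val_Suc_le[OF a(1), of n "\<lambda>q. \<alpha> q + \<beta> q"] by (simp only: push_add)
  also have "\<dots> \<le> (\<Sum>s\<in>S. val P n (push P \<alpha> a s) + mass (push P \<beta> a s))"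
    using a(1) Suc.prems by (intro sum_mono Suc.IH nonneg_push)
  also have "\<dots> = val P (Suc n) \<alpha> + mass \<beta>" by (simp only: a(2) sum.distrib mass_push[OF a(1)])
  finally show ?case .
qed (simp add: le_mass)

lemma val_le_mass: "nonneg_vec \<alpha> \<Longrightarrow> val P n \<alpha> \<le> mass \<alpha>"
  using val_add[of \<alpha> n "\<lambda>_. 0"] by (simp add: val_zero)

text \<open>The goal is absorbing, so its weight never decreases; this is the base case. An action
  that is optimal for the longer horizon gives the step.\<close>

lemma val_le_Suc: "nonneg_vec \<alpha> \<Longrightarrow> val P n \<alpha> \<le> val P (Suc n) \<alpha>"
proof (induction n arbitrary: \<alpha>)
  case 0
  obtain a where a: "a \<in> A" "val P (Suc 0) \<alpha> = (\<Sum>s\<in>S. val P 0 (push P \<alpha> a s))"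
    by (rule val_Suc_attained)
  let ?s = "pgoal_signal P"
  have s: "?s \<in> S" and one: "pr g a ?s g = 1" using P a(1) by (auto simp: pomdp_def)
  have "\<alpha> g = \<alpha> g * pr g a ?s g" using one by simp
  also have "\<dots> \<le> push P \<alpha> a ?s g"
    unfolding push_def using 0 a(1) s by (intro member_le_sum) (auto simp: nonneg_vec_def)
  also have "\<dots> \<le> (\<Sum>s\<in>S. push P \<alpha> a s g)"
    using nonneg_push[OF 0 a(1)] s by (intro member_le_sum) (auto simp: nonneg_vec_def)
  finally show ?case unfolding a(2) by simp
next
  case (Suc n)
  obtain a where a: "a \<in> A" "val P (Suc (Suc n)) \<alpha> = (\<Sum>s\<in>S. val P (Suc n) (push P \<alpha> a s))"
    by (rule val_Suc_attained)
  have "val P (Suc n) \<alpha> \<le> (\<Sum>s\<in>S. val P n (push P \<alpha> a s))" using a(1) by (rule val_Suc_le)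
  also have "\<dots> \<le> val P (Suc (Suc n)) \<alpha>"
    unfolding a(2) using Suc a(1) by (intro sum_mono Suc.IH nonneg_push)
  finally show ?case .
qed

lemma incseq_val: "nonneg_vec \<alpha> \<Longrightarrow> incseq (\<lambda>n. val P n \<alpha>)"
  by (intro incseq_SucI val_le_Suc)

lemma goal_le_val: "nonneg_vec \<alpha> \<Longrightarrow> \<alpha> g \<le> val P n \<alpha>"
  using incseqD[OF incseq_val, of \<alpha> 0 n] by simp

lemma bdd_val: "nonneg_vec \<alpha> \<Longrightarrow> bdd_above (range (\<lambda>n. val P n \<alpha>))"
  using val_le_mass by (intro bdd_aboveI) auto

lemma val_le_lval: "nonneg_vec \<alpha> \<Longrightarrow> val P n \<alpha> \<le> lval P \<alpha>"
  unfolding lval_def by (intro cSUP_upper bdd_val) auto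

lemma lval_leI: "(\<And>n. val P n \<alpha> \<le> c) \<Longrightarrow> lval P \<alpha> \<le> c"
  unfolding lval_def by (intro cSUP_least) auto

lemma lval_le_mass: "nonneg_vec \<alpha> \<Longrightarrow> lval P \<alpha> \<le> mass \<alpha>"
  by (intro lval_leI val_le_mass)

lemma val_tendsto_lval: "nonneg_vec \<alpha> \<Longrightarrow> (\<lambda>n. val P n \<alpha>) \<longlonglongrightarrow> lval P \<alpha>"
  unfolding lval_def by (intro LIMSEQ_incseq_SUP bdd_val incseq_val)

lemma lval_le_push:
  assumes "nonneg_vec \<alpha>" "a \<in> A"
  shows "lval P \<alpha> \<le> (\<Sum>s\<in>S. lval P (push P \<alpha> a s))"
proof (rule lval_leI)
  fix n
  have "val P n \<alpha> \<le> (\<Sum>s\<in>S. val P n (push P \<alpha> a s))"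
    using val_le_Suc[OF assms(1)] val_Suc_le[OF assms(2)] by (rule order_trans)
  also have "\<dots> \<le> (\<Sum>s\<in>S. lval P (push P \<alpha> a s))"
    using assms by (intro sum_mono val_le_lval nonneg_push)
  finally show "val P n \<alpha> \<le> (\<Sum>s\<in>S. lval P (push P \<alpha> a s))" .
qed

text \<open>Limit and minimum commute because there are finitely many actions: if every action
  exceeded \<open>lval P \<alpha>\<close>, one finite horizon would exceed it for all of them at
  once.\<close>

lemma lval_attained:
  assumes \<alpha>: "nonneg_vec \<alpha>"
  obtains a where "a \<in> A" "(\<Sum>s\<in>S. lval P (push P \<alpha> a s)) \<le> lval P \<alpha>"
proof (rule ccontr)
  assume no: "\<not> thesis"
  then have gt: "lval P \<alpha> < (\<Sum>s\<in>S. lval P (push P \<alpha> a s))" if "a \<in> A" for a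
    using that \<open>\<And>a. \<lbrakk>a \<in> A; (\<Sum>s\<in>S. lval P (push P \<alpha> a s)) \<le> lval P \<alpha>\<rbrakk> \<Longrightarrow> thesis\<close> by force
  have "\<exists>n. lval P \<alpha> < (\<Sum>s\<in>S. val P n (push P \<alpha> a s))" if a: "a \<in> A" for a
  proof -
    have "(\<lambda>n. \<Sum>s\<in>S. val P n (push P \<alpha> a s)) \<longlonglongrightarrow> (\<Sum>s\<in>S. lval P (push P \<alpha> a s))"
      using \<alpha> a by (intro tendsto_sum val_tendsto_lval nonneg_push)
    with gt[OF a] show ?thesis
      using order_tendstoD(1) eventually_happens' sequentially_bot by blast
  qed
  then obtain N where N: "\<And>a. a \<in> A \<Longrightarrow> lval P \<alpha> < (\<Sum>s\<in>S. val P (N a) (push P \<alpha> a s))"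
    by metis
  obtain a where a: "a \<in> A" "val P (Suc (Max (N ` A))) \<alpha> = (\<Sum>s\<in>S. val P (Max (N ` A)) (push P \<alpha> a s))"
    by (rule val_Suc_attained)
  have "lval P \<alpha> < (\<Sum>s\<in>S. val P (N a) (push P \<alpha> a s))" using N a(1) .
  also have "\<dots> \<le> (\<Sum>s\<in>S. val P (Max (N ` A)) (push P \<alpha> a s))"
    using \<alpha> a(1) by (intro sum_mono incseqD[OF incseq_val] nonneg_push) auto
  also have "\<dots> \<le> lval P \<alpha>" unfolding a(2)[symmetric] using \<alpha> by (rule val_le_lval)
  finally show False by simp
qed

section \<open>The rate of convergence\<close>

text \<open>The vector lies between two multiples of the indicator of its support, so positivity at
  a given horizon depends on the support only.\<close>

lemma val_pos_support:
  assumes \<alpha>: "nonneg_vec \<alpha>"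
  shows "val P n \<alpha> > 0 \<longleftrightarrow> val P n (indicator {q\<in>Q. \<alpha> q > 0}) > 0"
proof -
  let ?U = "{q\<in>Q. \<alpha> q > 0}"
  have nnU: "nonneg_vec (indicator ?U)" by (simp add: nonneg_vec_def)
  have "val P n \<alpha> \<le> val P n (\<lambda>q. mass \<alpha> * indicator ?U q)"
    using \<alpha> le_mass[OF \<alpha>] by (intro val_mono) (auto simp: indicator_def nonneg_vec_def)
  also have "\<dots> = mass \<alpha> * val P n (indicator ?U)" using mass_nonneg[OF \<alpha>] by (rule val_scale)
  finally have 1: "val P n \<alpha> \<le> mass \<alpha> * val P n (indicator ?U)" .
  \<comment> \<open>The element 1 keeps the set nonempty when the support is empty.\<close>
  define c where "c = Min (insert 1 (\<alpha> ` ?U))"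
  have c: "c > 0" "\<And>q. q \<in> ?U \<Longrightarrow> c \<le> \<alpha> q" by (auto simp: c_def)
  have "c * val P n (indicator ?U) = val P n (\<lambda>q. c * indicator ?U q)"
    using c(1) by (intro val_scale[symmetric]) simp
  also have "\<dots> \<le> val P n \<alpha>"
    using \<alpha> c(2) by (intro val_mono) (auto simp: indicator_def nonneg_vec_def)
  finally have 2: "c * val P n (indicator ?U) \<le> val P n \<alpha>" .
  show ?thesis
  proof
    assume "val P n (indicator ?U) > 0"
    with c(1) 2 show "val P n \<alpha> > 0" by (meson less_le_trans mult_pos_pos)
  next
    assume "val P n \<alpha> > 0"
    with 1 have "val P n (indicator ?U) \<noteq> 0" by auto
    with val_nonneg[OF nnU, of n] show "val P n (indicator ?U) > 0" by linarith
  qed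
qed

text \<open>The families \<open>F n\<close> of sets with positive value increase with
  \<open>n\<close>, and each determines the next. So they grow strictly until they stop for good,
  which takes at most as many steps as \<open>Q\<close> has subsets.\<close>

lemma val_indicator_pos:
  assumes U: "U \<subseteq> Q" and pos: "val P n (indicator U) > 0"
  shows "val P (2 ^ card Q) (indicator U) > 0"
proof -
  define F where "F n = {U \<in> Pow Q. val P n (indicator U) > 0}" for n
  have nnU: "nonneg_vec (indicator U)" for U by (simp add: nonneg_vec_def)
  \<comment> \<open>A sum of nonnegative values is positive iff some summand is, and
    \<open>val_pos_support\<close> replaces that summand by its support.\<close>
  have F_Suc: "F (Suc n) = {U \<in> Pow Q. \<forall>a\<in>A. \<exists>s\<in>S. {q\<in>Q. push P (indicator U) a s q > 0} \<in> F n}" for n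
  proof -
    have "val P (Suc n) (indicator U) > 0 \<longleftrightarrow> (\<forall>a\<in>A. \<exists>s\<in>S. val P n (push P (indicator U) a s) > 0)" for U
    proof -
      have "(\<Sum>s\<in>S. val P n (push P (indicator U) a s)) > 0 \<longleftrightarrow>
          (\<exists>s\<in>S. val P n (push P (indicator U) a s) > 0)" if "a \<in> A" for a
        using that val_nonneg[OF nonneg_push[OF nnU]]
        by (subst less_le) (auto simp: sum_nonneg sum_nonneg_eq_0_iff less_le)
      then show ?thesis using acts by (simp add: Min_gr_iff)
    qed
    then show ?thesis
      by (auto simp: F_def val_pos_support[OF nonneg_push[OF nnU]])
  qed
  have "F n \<subseteq> F (Suc n)" for n
    unfolding F_def using val_le_Suc[OF nnU] by (auto intro: less_le_trans simp del: val.simps)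
  then have mono: "mono F" by (intro mono_iff_le_Suc[THEN iffD2]) auto
  have "F (card (Pow Q)) = (\<Union>n. F n)"
  proof (rule finite_mono_strict_prefix_implies_finite_fixpoint)
    show "\<exists>N. (\<forall>n\<le>N. \<forall>m\<le>N. m < n \<longrightarrow> F m \<subset> F n) \<and> (\<forall>n\<ge>N. F N = F n)"
    proof (rule finite_mono_remains_stable_implies_strict_prefix[OF _ mono])
      have "range F \<subseteq> Pow (Pow Q)" by (auto simp: F_def)
      then show "finite (range F)" by (rule finite_subset) simp
      show "\<forall>n. F n = F (Suc n) \<longrightarrow> F (Suc n) = F (Suc (Suc n))"
        using F_Suc by presburger
    qed
  qed (auto simp: F_def)
  moreover have "U \<in> (\<Union>n. F n)" using U pos by (auto simp: F_def)
  ultimately have "U \<in> F (card (Pow Q))" by blast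
  then show ?thesis by (simp add: F_def card_Pow)
qed

lemma Nats_sum: "(\<And>x. x \<in> X \<Longrightarrow> f x \<in> \<nat>) \<Longrightarrow> sum f X \<in> \<nat>"
  by (induction X rule: infinite_finite_induct) auto

text \<open>Each step contributes one factor with denominator \<open>D\<close>. Hence a positive
  value is at least \<open>1 / D ^ n\<close>.\<close>

lemma val_Nats:
  assumes D: "\<And>q a s q'. q \<in> Q \<Longrightarrow> a \<in> A \<Longrightarrow> s \<in> S \<Longrightarrow> q' \<in> Q \<Longrightarrow> real D * pr q a s q' \<in> \<nat>"
    and "\<And>q. q \<in> Q \<Longrightarrow> \<alpha> q \<in> \<nat>"
  shows "real D ^ n * val P n \<alpha> \<in> \<nat>"
  using assms(2)
proof (induction n arbitrary: \<alpha>)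
  case (Suc n)
  obtain a where a: "a \<in> A" "val P (Suc n) \<alpha> = (\<Sum>s\<in>S. val P n (push P \<alpha> a s))"
    by (rule val_Suc_attained)
  have "real D ^ Suc n * val P (Suc n) \<alpha> = (\<Sum>s\<in>S. real D ^ n * (real D * val P n (push P \<alpha> a s)))"
    unfolding a(2) by (simp add: sum_distrib_left mult_ac)
  also have "\<dots> = (\<Sum>s\<in>S. real D ^ n * val P n (\<lambda>q. real D * push P \<alpha> a s q))"
    by (simp add: val_scale)
  also have "\<dots> \<in> \<nat>"
  proof (intro Nats_sum Suc.IH)
    fix s q' assume s: "s \<in> S" "q' \<in> Q"
    have "real D * push P \<alpha> a s q' = (\<Sum>q\<in>Q. \<alpha> q * (real D * pr q a s q'))"
      by (simp add: push_def sum_distrib_left mult_ac)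
    also have "\<dots> \<in> \<nat>" using s a(1) by (intro Nats_sum Nats_mult Suc.prems D) auto
    finally show "real D * push P \<alpha> a s q' \<in> \<nat>" .
  qed
  finally show ?case .
qed simp

lemma lval_small_or_val_large:
  assumes D: "\<And>q a s q'. q \<in> Q \<Longrightarrow> a \<in> A \<Longrightarrow> s \<in> S \<Longrightarrow> q' \<in> Q \<Longrightarrow> real D * pr q a s q' \<in> \<nat>"
    and D0: "D > 0" and E: "E > 0" and \<alpha>: "nonneg_vec \<alpha>"
  defines "N \<equiv> 2 ^ card Q"
  shows "lval P \<alpha> \<le> mass \<alpha> / real E \<or> mass \<alpha> \<le> real (E * card Q * D ^ N) * val P N \<alpha>"
proof -
  \<comment> \<open>At most \<open>card Q\<close> entries lie below \<open>t\<close>, so together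
    they carry at most \<open>mass \<alpha> / E\<close>.\<close>
  define t where "t = mass \<alpha> / (real E * real (card Q))"
  define U where "U = {q\<in>Q. t \<le> \<alpha> q}"
  have Q0: "card Q > 0" "Q \<noteq> {}" using gQ by (auto simp: card_gt_0_iff simp del: gQ)
  have t0: "0 \<le> t" using mass_nonneg[OF \<alpha>] by (simp add: t_def)
  have nnU: "nonneg_vec (indicator U)" by (simp add: nonneg_vec_def)
  show ?thesis
  proof (cases "val P N (indicator U) > 0")
    case False
    have "lval P \<alpha> \<le> mass \<alpha> / real E"
    proof (rule lval_leI)
      fix n
      have "\<not> val P n (indicator U) > 0"
        using val_indicator_pos[of U n] False by (auto simp: U_def N_def)
      then have n0: "val P n (indicator U) = 0" using val_nonneg[OF nnU, of n] by linarith
      \<comment> \<open>On \<open>U\<close> the vector is dominated by a multiple of the indicator,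
        which has value 0; only the small entries remain.\<close>
      let ?\<beta> = "\<lambda>q. if q \<in> U then 0 else \<alpha> q"
      have "val P n \<alpha> \<le> val P n (\<lambda>q. mass \<alpha> * indicator U q + ?\<beta> q)"
        using le_mass[OF \<alpha>] by (intro val_mono) (auto simp: indicator_def)
      also have "\<dots> \<le> val P n (\<lambda>q. mass \<alpha> * indicator U q) + mass ?\<beta>"
        using \<alpha> by (intro val_add) (auto simp: nonneg_vec_def)
      also have "val P n (\<lambda>q. mass \<alpha> * indicator U q) = 0"
        by (subst val_scale) (simp_all add: mass_nonneg[OF \<alpha>] n0)
      also have "mass ?\<beta> \<le> (\<Sum>q\<in>Q. t)"
        unfolding mass_def using t0 by (intro sum_mono) (auto simp: U_def)
      also have "\<dots> = mass \<alpha> / real E" using Q0 by (auto simp: t_def)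
      finally show "val P n \<alpha> \<le> mass \<alpha> / real E" by simp
    qed
    then show ?thesis ..
  next
    case True
    have "real D ^ N * val P N (indicator U) \<in> \<nat>"
      using D by (rule val_Nats) (auto simp: indicator_def)
    then obtain m where m: "real D ^ N * val P N (indicator U) = real m" by (auto elim: Nats_cases)
    have "real m > 0" unfolding m[symmetric] using True D0 by simp
    then have ge1: "1 \<le> real D ^ N * val P N (indicator U)" unfolding m by simp
    have "t * val P N (indicator U) = val P N (\<lambda>q. t * indicator U q)"
      using t0 by (rule val_scale[symmetric])
    also have "\<dots> \<le> val P N \<alpha>"
      using \<alpha> by (intro val_mono) (auto simp: U_def indicator_def nonneg_vec_def)
    finally have le: "t * val P N (indicator U) \<le> val P N \<alpha>" .
    have "mass \<alpha> = real E * real (card Q) * t * 1" using E Q0 by (simp add: t_def)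
    also have "\<dots> \<le> real E * real (card Q) * t * (real D ^ N * val P N (indicator U))"
      using ge1 t0 by (intro mult_left_mono) auto
    also have "\<dots> = real (E * card Q * D ^ N) * (t * val P N (indicator U))" by simp
    also have "\<dots> \<le> real (E * card Q * D ^ N) * val P N \<alpha>"
      using le by (intro mult_left_mono) auto
    finally show ?thesis ..
  qed
qed

text \<open>The leaves of an optimal plan for the first \<open>N\<close> of \<open>N + m\<close> steps.\<close>

lemma leaves:
  assumes "nonneg_vec \<alpha>" "consistent \<alpha>"
  shows "\<exists>L. (\<forall>\<beta>\<in>set L. nonneg_vec \<beta> \<and> consistent \<beta>) \<and> val P (N + m) \<alpha> = (\<Sum>\<beta>\<leftarrow>L. val P m \<beta>) \<and>
    lval P \<alpha> \<le> (\<Sum>\<beta>\<leftarrow>L. lval P \<beta>) \<and> val P N \<alpha> \<le> (\<Sum>\<beta>\<leftarrow>L. \<beta> g) \<and> mass \<alpha> = (\<Sum>\<beta>\<leftarrow>L. mass \<beta>)"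
  using assms
proof (induction N arbitrary: \<alpha>)
  case 0
  then show ?case by (intro exI[of _ "[\<alpha>]"]) simp
next
  case (Suc N)
  \<comment> \<open>The action is optimal for the horizon \<open>Suc (N + m)\<close> only, so
    \<open>lval\<close> and the shorter horizon \<open>Suc N\<close> get just the inequalities that
    hold for every action.\<close>
  obtain a where a: "a \<in> A" "val P (Suc (N + m)) \<alpha> = (\<Sum>s\<in>S. val P (N + m) (push P \<alpha> a s))"
    by (rule val_Suc_attained)
  have "\<forall>s\<in>S. \<exists>L. (\<forall>\<beta>\<in>set L. nonneg_vec \<beta> \<and> consistent \<beta>) \<and>
    val P (N + m) (push P \<alpha> a s) = (\<Sum>\<beta>\<leftarrow>L. val P m \<beta>) \<and>
    lval P (push P \<alpha> a s) \<le> (\<Sum>\<beta>\<leftarrow>L. lval P \<beta>) \<and> val P N (push P \<alpha> a s) \<le> (\<Sum>\<beta>\<leftarrow>L. \<beta> g) \<and>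
    mass (push P \<alpha> a s) = (\<Sum>\<beta>\<leftarrow>L. mass \<beta>)"
    using Suc.IH nonneg_push[OF Suc.prems(1) a(1)] consistent_push[OF a(1)] by blast
  then obtain L where L: "\<And>s \<beta>. s \<in> S \<Longrightarrow> \<beta> \<in> set (L s) \<Longrightarrow> nonneg_vec \<beta> \<and> consistent \<beta>"
    "\<And>s. s \<in> S \<Longrightarrow> val P (N + m) (push P \<alpha> a s) = (\<Sum>\<beta>\<leftarrow>L s. val P m \<beta>)"
    "\<And>s. s \<in> S \<Longrightarrow> lval P (push P \<alpha> a s) \<le> (\<Sum>\<beta>\<leftarrow>L s. lval P \<beta>)"
    "\<And>s. s \<in> S \<Longrightarrow> val P N (push P \<alpha> a s) \<le> (\<Sum>\<beta>\<leftarrow>L s. \<beta> g)"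
    "\<And>s. s \<in> S \<Longrightarrow> mass (push P \<alpha> a s) = (\<Sum>\<beta>\<leftarrow>L s. mass \<beta>)"
    unfolding bchoice_iff by blast
  obtain ss where ss: "set ss = S" "distinct ss" using finite_distinct_list[OF fin(3)] by blast
  have sum: "(\<Sum>\<beta>\<leftarrow>concat (map L ss). f \<beta>) = (\<Sum>s\<in>S. \<Sum>\<beta>\<leftarrow>L s. f \<beta>)" for f :: "('q \<Rightarrow> real) \<Rightarrow> real"
  proof -
    have "(\<Sum>\<beta>\<leftarrow>concat (map L ss). f \<beta>) = (\<Sum>s\<leftarrow>ss. \<Sum>\<beta>\<leftarrow>L s. f \<beta>)"
      by (induction ss) auto
    then show ?thesis using ss by (simp add: sum_list_distinct_conv_sum_set)
  qed
  show ?case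
  proof (intro exI[of _ "concat (map L ss)"] conjI)
    show "\<forall>\<beta>\<in>set (concat (map L ss)). nonneg_vec \<beta> \<and> consistent \<beta>" using L(1) ss by auto
    show "val P (Suc N + m) \<alpha> = (\<Sum>\<beta>\<leftarrow>concat (map L ss). val P m \<beta>)"
      unfolding sum using a(2) L(2) by (simp del: val.simps)
    have "lval P \<alpha> \<le> (\<Sum>s\<in>S. lval P (push P \<alpha> a s))" by (rule lval_le_push[OF Suc.prems(1) a(1)])
    also have "\<dots> \<le> (\<Sum>s\<in>S. \<Sum>\<beta>\<leftarrow>L s. lval P \<beta>)" by (intro sum_mono L(3))
    finally show "lval P \<alpha> \<le> (\<Sum>\<beta>\<leftarrow>concat (map L ss). lval P \<beta>)" unfolding sum .
    have "val P (Suc N) \<alpha> \<le> (\<Sum>s\<in>S. val P N (push P \<alpha> a s))" by (rule val_Suc_le[OF a(1)])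
    also have "\<dots> \<le> (\<Sum>s\<in>S. \<Sum>\<beta>\<leftarrow>L s. \<beta> g)" by (intro sum_mono L(4))
    finally show "val P (Suc N) \<alpha> \<le> (\<Sum>\<beta>\<leftarrow>concat (map L ss). \<beta> g)" unfolding sum .
    have "mass \<alpha> = (\<Sum>s\<in>S. mass (push P \<alpha> a s))" by (rule mass_push[OF a(1), symmetric])
    also have "\<dots> = (\<Sum>s\<in>S. \<Sum>\<beta>\<leftarrow>L s. mass \<beta>)" by (intro sum.cong refl L(5))
    finally show "mass \<alpha> = (\<Sum>\<beta>\<leftarrow>concat (map L ss). mass \<beta>)" unfolding sum .
  qed
qed

text \<open>Along an optimal plan, each block of \<open>N\<close> steps is paid for either by \<open>mass \<alpha> / E\<close> or by the
  fraction \<open>1 / R\<close> of the mass that enters the goal during the block. The last summand is the mass that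
  still enters the goal before the horizon, so over all blocks the second kind of payment is bounded.\<close>

lemma lval_iterate:
  fixes E R :: real
  assumes dich: "\<And>\<alpha>. nonneg_vec \<alpha> \<Longrightarrow> lval P \<alpha> \<le> mass \<alpha> / E \<or> mass \<alpha> \<le> R * val P N \<alpha>"
    and E: "E > 0" and R: "R \<ge> 0" and \<alpha>: "nonneg_vec \<alpha>" "consistent \<alpha>"
  shows "real K * lval P \<alpha> \<le> real K * val P (K * N) \<alpha> + real K * (mass \<alpha> / E) + R * (val P (K * N) \<alpha> - \<alpha> g)"
  using \<alpha>
proof (induction K arbitrary: \<alpha>)
  case 0
  then show ?case by simp
next
  case (Suc K)
  let ?M = "Suc K * N"
  have R': "0 \<le> R * (val P ?M \<alpha> - \<alpha> g)"
    using R goal_le_val[OF Suc.prems(1), of ?M] by simp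
  have v0: "0 \<le> val P ?M \<alpha>" by (rule val_nonneg[OF Suc.prems(1)])
  have m0: "0 \<le> mass \<alpha> / E" using mass_nonneg[OF Suc.prems(1)] E by simp
  consider "lval P \<alpha> \<le> mass \<alpha> / E" | "\<forall>q\<in>Q - {g}. \<alpha> q = 0" | "\<alpha> g = 0" "mass \<alpha> \<le> R * val P N \<alpha>"
    using dich[OF Suc.prems(1)] Suc.prems(2) by (auto simp: consistent_def)
  then show ?case
  proof cases
    case 1
    then have "real (Suc K) * lval P \<alpha> \<le> real (Suc K) * (mass \<alpha> / E)"
      by (intro mult_left_mono) auto
    moreover have "0 \<le> real (Suc K) * val P ?M \<alpha>" using v0 by (intro mult_nonneg_nonneg) auto
    ultimately show ?thesis using R' by linarith
  next
    case 2
    \<comment> \<open>All mass is in the goal already, so every horizon attains the limit.\<close>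
    have "mass \<alpha> = \<alpha> g" using 2 by (simp add: mass_def sum.remove[OF fin(1) gQ])
    then have "lval P \<alpha> \<le> val P ?M \<alpha>"
      using lval_le_mass[OF Suc.prems(1)] goal_le_val[OF Suc.prems(1), of ?M] by linarith
    then have "real (Suc K) * lval P \<alpha> \<le> real (Suc K) * val P ?M \<alpha>"
      by (intro mult_left_mono) auto
    moreover have "0 \<le> real (Suc K) * (mass \<alpha> / E)" using m0 by (intro mult_nonneg_nonneg) auto
    ultimately show ?thesis using R' by linarith
  next
    case 3
    obtain L where L: "\<forall>\<beta>\<in>set L. nonneg_vec \<beta> \<and> consistent \<beta>"
      "val P (N + K * N) \<alpha> = (\<Sum>\<beta>\<leftarrow>L. val P (K * N) \<beta>)" "lval P \<alpha> \<le> (\<Sum>\<beta>\<leftarrow>L. lval P \<beta>)"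
      "val P N \<alpha> \<le> (\<Sum>\<beta>\<leftarrow>L. \<beta> g)" "mass \<alpha> = (\<Sum>\<beta>\<leftarrow>L. mass \<beta>)"
      using leaves[OF Suc.prems, of N "K * N"] by blast
    have "real K * lval P \<alpha> \<le> (\<Sum>\<beta>\<leftarrow>L. real K * lval P \<beta>)"
      using L(3) by (simp add: sum_list_const_mult mult_left_mono)
    also have "\<dots> \<le> (\<Sum>\<beta>\<leftarrow>L. real K * val P (K * N) \<beta> + real K * (mass \<beta> / E) + R * (val P (K * N) \<beta> - \<beta> g))"
      using L(1) Suc.IH by (intro sum_list_mono) auto
    also have "\<dots> = real K * (\<Sum>\<beta>\<leftarrow>L. val P (K * N) \<beta>) + real K * ((\<Sum>\<beta>\<leftarrow>L. mass \<beta>) / E)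
        + R * ((\<Sum>\<beta>\<leftarrow>L. val P (K * N) \<beta>) - (\<Sum>\<beta>\<leftarrow>L. \<beta> g))"
      by (induction L) (simp_all add: algebra_simps add_divide_distrib)
    also have "\<dots> = real K * val P ?M \<alpha> + real K * (mass \<alpha> / E) + R * (val P ?M \<alpha> - (\<Sum>\<beta>\<leftarrow>L. \<beta> g))"
      using L(2,5) by simp
    also have "\<dots> \<le> real K * val P ?M \<alpha> + real K * (mass \<alpha> / E) + R * (val P ?M \<alpha> - val P N \<alpha>)"
      using L(4) R by (intro add_mono mult_left_mono) auto
    \<comment> \<open>By \<open>3(2)\<close> the weight that enters the goal in this block pays for
      all of \<open>mass \<alpha>\<close>. This in turn pays for one more
      \<open>lval P \<alpha>\<close>, which raises the factor \<open>K\<close> to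
      \<open>Suc K\<close>.\<close>
    also have "\<dots> \<le> real K * val P ?M \<alpha> + real K * (mass \<alpha> / E) + R * val P ?M \<alpha> - mass \<alpha>"
      using 3(2) by (simp add: algebra_simps)
    finally have "real K * lval P \<alpha> + lval P \<alpha> \<le> real K * val P ?M \<alpha> + real K * (mass \<alpha> / E) + R * val P ?M \<alpha>"
      using lval_le_mass[OF Suc.prems(1)] by linarith
    then show ?thesis using 3(1) v0 m0 by (simp add: algebra_simps add_divide_distrib)
  qed
qed

lemma lval_le_val:
  assumes D: "\<And>q a s q'. q \<in> Q \<Longrightarrow> a \<in> A \<Longrightarrow> s \<in> S \<Longrightarrow> q' \<in> Q \<Longrightarrow> real D * pr q a s q' \<in> \<nat>"
    and D0: "D > 0" and E: "E > 0" and \<alpha>: "nonneg_vec \<alpha>" "consistent \<alpha>"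
  defines "N \<equiv> 2 ^ card Q"
  shows "lval P \<alpha> \<le> val P (E * (E * card Q * D ^ N) * N) \<alpha> + 2 / real E * mass \<alpha>"
proof -
  let ?R = "E * card Q * D ^ N"
  \<comment> \<open>With this many blocks, the payments of the second kind, at most
    \<open>?R * mass \<alpha>\<close> in total, become \<open>mass \<alpha> / E\<close> after
    division by \<open>?K\<close>.\<close>
  let ?K = "E * ?R"
  let ?v = "val P (?K * N) \<alpha>"
  have Q0: "card Q > 0" "Q \<noteq> {}" using gQ by (auto simp: card_gt_0_iff simp del: gQ)
  have K0: "real ?K > 0" using E Q0 D0 by simp
  have "?v - \<alpha> g \<le> mass \<alpha>"
    using \<alpha>(1) val_le_mass[OF \<alpha>(1), of "?K * N"] gQ unfolding nonneg_vec_def by (smt (verit))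
  then have "real ?R * (?v - \<alpha> g) \<le> real ?R * mass \<alpha>" by (intro mult_left_mono) auto
  also have "\<dots> = real ?K * (mass \<alpha> / real E)" using E by simp
  finally have R: "real ?R * (?v - \<alpha> g) \<le> real ?K * (mass \<alpha> / real E)" .
  have "real ?K * lval P \<alpha> \<le> real ?K * ?v + real ?K * (mass \<alpha> / real E) + real ?R * (?v - \<alpha> g)"
    using lval_small_or_val_large[OF D D0 E] E \<alpha>
    by (intro lval_iterate) (auto simp: N_def)
  also have "\<dots> \<le> real ?K * ?v + real ?K * (mass \<alpha> / real E) + real ?K * (mass \<alpha> / real E)"
    using R by (rule add_left_mono)
  also have "\<dots> = real ?K * (?v + 2 / real E * mass \<alpha>)"
    by (simp only: distrib_left[symmetric]) simp
  finally have "real ?K * lval P \<alpha> \<le> real ?K * (?v + 2 / real E * mass \<alpha>)" .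
  then show ?thesis using K0 by (simp only: mult_le_cancel_left_pos)
qed

end

section \<open>The infimum over schedulers of the belief MDP\<close>

context pomdp_model
begin

abbreviation "rb b \<equiv> (\<lambda>q. real_of_rat (b q))"

text \<open>The probability of observing \<open>s\<close>, which is the denominator in
  \<open>upd\<close>.\<close>

definition signal_weight :: "('q \<Rightarrow> rat) \<Rightarrow> 'a \<Rightarrow> 'o \<Rightarrow> rat" where
  "signal_weight b a s = (\<Sum>q\<in>Q. b q * (\<Sum>q'\<in>Q. ptrans P q a s q'))"

lemma signal_weight_nonneg: "b \<in> beliefs P \<Longrightarrow> a \<in> A \<Longrightarrow> s \<in> S \<Longrightarrow> 0 \<le> signal_weight b a s"
  unfolding signal_weight_def by (intro sum_nonneg mult_nonneg_nonneg) (auto simp: beliefs_def)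

text \<open>Normalisation cancels. At weight 0 both sides are 0, as no state with positive belief
  can then emit \<open>s\<close>.\<close>

lemma push_belief:
  assumes "b \<in> beliefs P" "a \<in> A" "s \<in> S" "q' \<in> Q"
  shows "push P (rb b) a s q' = real_of_rat (signal_weight b a s) * rb (upd P b a s) q'"
proof (cases "signal_weight b a s = 0")
  case True
  have "\<forall>q\<in>Q. b q * (\<Sum>q'\<in>Q. ptrans P q a s q') = 0"
    using True assms unfolding signal_weight_def
    by (subst (asm) sum_nonneg_eq_0_iff) (auto simp: beliefs_def intro!: mult_nonneg_nonneg sum_nonneg)
  then have "b q * ptrans P q a s q' = 0" if "q \<in> Q" for q
    using that assms by (auto simp: sum_nonneg_eq_0_iff)
  then have "push P (rb b) a s q' = 0"
    unfolding push_def by (intro sum.neutral) (auto simp flip: of_rat_mult)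
  then show ?thesis using True by simp
next
  case False
  then have "signal_weight b a s * upd P b a s q' = (\<Sum>q\<in>Q. b q * ptrans P q a s q')"
    using assms(4) by (simp add: upd_def signal_weight_def)
  then show ?thesis by (simp add: push_def flip: of_rat_mult of_rat_sum)
qed

lemma upd_belief:
  assumes b: "b \<in> beliefs P" "a \<in> A" "s \<in> S" and w: "signal_weight b a s > 0"
  shows "upd P b a s \<in> beliefs P" "consistent (rb (upd P b a s))"
proof -
  let ?w = "real_of_rat (signal_weight b a s)"
  have w': "?w > 0" using w by simp
  have push: "rb (upd P b a s) q = push P (rb b) a s q / ?w" if "q \<in> Q" for q
    using push_belief[OF b that] w' by (simp add: field_simps)
  have "nonneg_vec (push P (rb b) a s)" using b by (intro nonneg_push) (auto simp: nonneg_vec_def beliefs_def)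
  then have "0 \<le> rb (upd P b a s) q" if "q \<in> Q" for q
    using that w' push[OF that] by (simp add: nonneg_vec_def)
  then have nonneg: "0 \<le> upd P b a s q" if "q \<in> Q" for q using that by simp
  have "(\<Sum>q\<in>Q. upd P b a s q) = (\<Sum>q'\<in>Q. \<Sum>q\<in>Q. b q * ptrans P q a s q') / signal_weight b a s"
    by (simp add: upd_def signal_weight_def sum_divide_distrib)
  also have "(\<Sum>q'\<in>Q. \<Sum>q\<in>Q. b q * ptrans P q a s q') = signal_weight b a s"
    unfolding signal_weight_def by (subst sum.swap) (simp add: sum_distrib_left)
  finally show "upd P b a s \<in> beliefs P"
    using w nonneg by (auto simp: beliefs_def upd_def)
  show "consistent (rb (upd P b a s))"
    using consistent_push[OF b(2,3), of "rb b"] push by (auto simp: consistent_def)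
qed

text \<open>Distinct signals may lead to the same belief, so the sum over successors is regrouped by
  signals. Signals of weight 0 do not lead to a belief, but contribute 0.\<close>

lemma expected_belief:
  assumes b: "b \<in> beliefs P" "a \<in> A"
  shows "expected (belief_mdp P) b a f
    = (\<Sum>s\<in>S. ennreal (real_of_rat (signal_weight b a s)) * f (upd P b a s))"
proof -
  let ?w = "\<lambda>s. ennreal (real_of_rat (signal_weight b a s))"
  have st: "mstates (belief_mdp P) = beliefs P" by (simp add: belief_mdp_def)
  have tr: "mtrans (belief_mdp P) b a b' = (\<Sum>s\<in>S. if upd P b a s = b' then signal_weight b a s else 0)" for b'
    unfolding signal_weight_def sum_distrib_left
    by (simp add: belief_mdp_def sum.inter_filter del: if_distrib)
  have "ennreal (real_of_rat (mtrans (belief_mdp P) b a b')) * f b'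
      = (\<Sum>s\<in>S. ?w s * f (upd P b a s) * indicator {upd P b a s} b')" for b'
  proof -
    have "ennreal (real_of_rat (mtrans (belief_mdp P) b a b'))
      = (\<Sum>s\<in>S. ennreal (real_of_rat (if upd P b a s = b' then signal_weight b a s else 0)))"
      unfolding tr of_rat_sum using signal_weight_nonneg[OF b] by (intro sum_ennreal[symmetric]) auto
    then have "ennreal (real_of_rat (mtrans (belief_mdp P) b a b')) * f b'
      = (\<Sum>s\<in>S. ennreal (real_of_rat (if upd P b a s = b' then signal_weight b a s else 0)) * f b')"
      by (simp only: sum_distrib_right)
    also have "\<dots> = (\<Sum>s\<in>S. ?w s * f (upd P b a s) * indicator {upd P b a s} b')"
      by (rule sum.cong) auto
    finally show ?thesis .
  qed
  then have "expected (belief_mdp P) b a f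
      = (\<Sum>s\<in>S. \<integral>\<^sup>+b'. ?w s * f (upd P b a s) * indicator {upd P b a s} b' \<partial>count_space (beliefs P))"
    unfolding expected_def st by (simp only:) (rule nn_integral_sum, simp)
  also have "\<dots> = (\<Sum>s\<in>S. ?w s * f (upd P b a s))"
  proof (intro sum.cong refl)
    fix s assume s: "s \<in> S"
    show "(\<integral>\<^sup>+b'. ?w s * f (upd P b a s) * indicator {upd P b a s} b' \<partial>count_space (beliefs P))
      = ?w s * f (upd P b a s)"
    proof (cases "signal_weight b a s > 0")
      case True
      then show ?thesis using upd_belief(1)[OF b s True] by (subst nn_integral_cmult_indicator) simp_all
    next
      case False
      then have "signal_weight b a s = 0" using signal_weight_nonneg[OF b s] by simp
      then show ?thesis by simp
    qed
  qed
  finally show ?thesis .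
qed

lemma nonneg_belief: "b \<in> beliefs P \<Longrightarrow> nonneg_vec (rb b)"
  by (auto simp: beliefs_def nonneg_vec_def)

lemma mass_belief: "b \<in> beliefs P \<Longrightarrow> mass (rb b) = 1"
  by (auto simp: beliefs_def mass_def simp flip: of_rat_sum)

text \<open>The goal carries none or all of the total weight 1. This identifies
  \<open>val P 0\<close> with the indicator of the target.\<close>

lemma belief_eq_goal:
  assumes "b \<in> beliefs P" "consistent (rb b)"
  shows "b g = (if b = point_belief g then 1 else 0)"
proof (cases "b g = 0")
  case False
  with assms have *: "b q = 0" if "q \<noteq> g" for q
    using that by (cases "q \<in> Q") (auto simp: consistent_def beliefs_def)
  have "(\<Sum>q\<in>Q. b q) = b g" using * by (simp add: sum.remove[OF fin(1) gQ])
  then have "b g = 1" using assms(1) by (simp add: beliefs_def)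
  then show ?thesis using * by (auto simp: point_belief_def fun_eq_iff)
qed (auto simp: point_belief_def)

text \<open>Homogeneity lets \<open>F\<close> absorb the signal weight, which turns normalised
  updates into \<open>push\<close>. \<open>f\<close> matters only at updates of positive weight, and
  these are consistent. The instances of \<open>F\<close> are \<open>val P m\<close> and
  \<open>lval P\<close>.\<close>

lemma expected_consistent:
  assumes b: "b \<in> beliefs P" "a \<in> A"
    and F: "\<And>\<alpha> \<beta>. (\<And>q. q \<in> Q \<Longrightarrow> \<alpha> q = \<beta> q) \<Longrightarrow> F \<alpha> = F \<beta>"
    and scale: "\<And>c \<alpha>. 0 \<le> c \<Longrightarrow> nonneg_vec \<alpha> \<Longrightarrow> F (\<lambda>q. c * \<alpha> q) = c * F \<alpha>"
    and F0: "\<And>\<alpha>. nonneg_vec \<alpha> \<Longrightarrow> 0 \<le> F \<alpha>"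
    and f: "\<And>b. b \<in> beliefs P \<Longrightarrow> consistent (rb b) \<Longrightarrow> f b = ennreal (F (rb b))"
  shows "expected (belief_mdp P) b a f = ennreal (\<Sum>s\<in>S. F (push P (rb b) a s))"
proof -
  have "ennreal (real_of_rat (signal_weight b a s)) * f (upd P b a s) = ennreal (F (push P (rb b) a s))"
    if s: "s \<in> S" for s
  proof -
    have w: "0 \<le> real_of_rat (signal_weight b a s)" using signal_weight_nonneg[OF b s] by simp
    show ?thesis
    proof (cases "signal_weight b a s > 0")
      case True
      note u = upd_belief[OF b s True]
      have "F (push P (rb b) a s) = real_of_rat (signal_weight b a s) * F (rb (upd P b a s))"
        using F[OF push_belief[OF b s]] by (simp add: scale[OF w nonneg_belief[OF u(1)]])
      then show ?thesis using w f[OF u] F0[OF nonneg_belief[OF u(1)]] by (simp add: ennreal_mult)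
    next
      case False
      then have w0: "signal_weight b a s = 0" using w by simp
      then have "F (push P (rb b) a s) = F (\<lambda>q. 0 * 0)"
        using push_belief[OF b s] by (intro F) simp
      also have "\<dots> = 0" using scale[of 0 "\<lambda>_. 0"] by (simp add: nonneg_vec_def)
      finally show ?thesis using w0 by simp
    qed
  qed
  moreover have "0 \<le> F (push P (rb b) a s)" if "s \<in> S" for s
    by (intro F0 nonneg_push nonneg_belief b that)
  ultimately show ?thesis by (simp add: expected_belief[OF b] sum_ennreal)
qed

lemma belief_mdp_simps: "mstates (belief_mdp P) = beliefs P"
  "b \<in> beliefs P \<Longrightarrow> enabled (belief_mdp P) b = A"
  using belief_mdp_enabled[OF P, of b] by (auto simp: enabled_def belief_mdp_def)

lemma lval_scale:
  assumes "0 \<le> c" "nonneg_vec \<alpha>" shows "lval P (\<lambda>q. c * \<alpha> q) = c * lval P \<alpha>"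
proof (rule LIMSEQ_unique)
  show "(\<lambda>n. val P n (\<lambda>q. c * \<alpha> q)) \<longlonglongrightarrow> lval P (\<lambda>q. c * \<alpha> q)"
    using assms by (intro val_tendsto_lval) (simp add: nonneg_vec_def)
  show "(\<lambda>n. val P n (\<lambda>q. c * \<alpha> q)) \<longlonglongrightarrow> c * lval P \<alpha>"
    using assms by (simp add: val_scale) (intro tendsto_mult_left val_tendsto_lval)
qed

lemma val_le_inf_reach:
  assumes b0: "b0 \<in> beliefs P" "consistent (rb b0)"
  shows "val P n (rb b0) \<le> inf_reach (belief_mdp P) b0 {point_belief g}"
proof -
  \<comment> \<open>A belief with only part of its weight on the goal is not the target, yet
    \<open>val P 0\<close> is positive there; the trivial lower bound 0 takes its place.\<close>
  define f where "f m b = (if consistent (rb b) then ennreal (val P m (rb b)) else 0)" for m b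
  have "f n b0 \<le> ennreal (inf_reach (belief_mdp P) b0 {point_belief g})"
  proof (rule inf_reach_ge[where f = f])
    show "mdp (belief_mdp P)" using P by (rule mdp_belief_mdp)
    show "b0 \<in> mstates (belief_mdp P)" using b0 by (simp add: belief_mdp_simps)
  next
    fix b assume "b \<in> mstates (belief_mdp P)"
    then show "f 0 b \<le> indicator {point_belief g} b"
      using belief_eq_goal[of b] by (auto simp: f_def belief_mdp_simps indicator_def)
  next
    fix m b a assume "b \<in> mstates (belief_mdp P)" "a \<in> enabled (belief_mdp P) b"
    then have b: "b \<in> beliefs P" "a \<in> A" by (simp_all add: belief_mdp_simps)
    have "expected (belief_mdp P) b a (f m) = ennreal (\<Sum>s\<in>S. val P m (push P (rb b) a s))"
      using b by (rule expected_consistent) (auto intro: val_cong val_scale val_nonneg simp: f_def)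
    moreover have "f (Suc m) b \<le> ennreal (\<Sum>s\<in>S. val P m (push P (rb b) a s))"
      unfolding f_def using val_Suc_le[OF b(2)] by (auto intro: ennreal_leI simp del: val.simps)
    ultimately show "f (Suc m) b \<le> expected (belief_mdp P) b a (f m)" by simp
  next
    fix m b assume "b \<in> mstates (belief_mdp P)" "enabled (belief_mdp P) b = {}"
    then show "f (Suc m) b \<le> f m b" using acts by (simp add: belief_mdp_simps)
  qed
  moreover have "0 \<le> inf_reach (belief_mdp P) b0 {point_belief g}"
    unfolding inf_reach_def by (intro cINF_greatest schedulers_nonempty) simp
  ultimately show ?thesis using b0(2) by (simp add: f_def)
qed

lemma inf_reach_le_lval:
  assumes b0: "b0 \<in> beliefs P" "consistent (rb b0)"
  shows "inf_reach (belief_mdp P) b0 {point_belief g} \<le> lval P (rb b0)"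
proof -
  \<comment> \<open>Inconsistent beliefs get the trivial upper bound 1; it satisfies the step
    condition since \<open>lval\<close> is at most the mass 1.\<close>
  define v where "v b = (if consistent (rb b) then ennreal (lval P (rb b)) else 1)" for b
  have lval_nonneg: "0 \<le> lval P \<alpha>" if "nonneg_vec \<alpha>" for \<alpha>
    using val_nonneg[OF that] val_le_lval[OF that] by (rule order_trans)
  have exp: "expected (belief_mdp P) b a v = ennreal (\<Sum>s\<in>S. lval P (push P (rb b) a s))"
    if "b \<in> beliefs P" "a \<in> A" for b a
    using that
  proof (rule expected_consistent)
    show "lval P \<alpha> = lval P \<beta>" if "\<And>q. q \<in> Q \<Longrightarrow> \<alpha> q = \<beta> q" for \<alpha> \<beta>
      using val_cong[OF that] by (simp add: lval_def)
  qed (auto intro: lval_scale lval_nonneg simp: v_def)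
  have "ennreal (inf_reach (belief_mdp P) b0 {point_belief g}) \<le> v b0"
  proof (rule inf_reach_le)
    show "mdp (belief_mdp P)" using P by (rule mdp_belief_mdp)
    show "b0 \<in> mstates (belief_mdp P)" using b0 by (simp add: belief_mdp_simps)
  next
    fix b assume "b \<in> mstates (belief_mdp P)" "b \<in> {point_belief g}"
    then have b: "b \<in> beliefs P" "b = point_belief g" by (simp_all add: belief_mdp_simps)
    have "1 \<le> lval P (rb b)"
      using val_le_lval[OF nonneg_belief[OF b(1)], of 0] by (simp add: b(2) point_belief_def)
    then show "1 \<le> v b" by (simp add: v_def)
  next
    fix b assume "b \<in> mstates (belief_mdp P)"
    then have b: "b \<in> beliefs P" by (simp add: belief_mdp_simps)
    show "\<exists>a\<in>enabled (belief_mdp P) b. expected (belief_mdp P) b a v \<le> v b"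
    proof -
      obtain a where a: "a \<in> A" "(\<Sum>s\<in>S. lval P (push P (rb b) a s)) \<le> lval P (rb b)"
        using lval_attained[OF nonneg_belief[OF b]] by blast
      have "lval P (rb b) \<le> 1" using lval_le_mass[OF nonneg_belief[OF b]] by (simp add: mass_belief[OF b])
      then have "expected (belief_mdp P) b a v \<le> v b"
        unfolding exp[OF b a(1)] v_def using a(2) by (auto intro!: ennreal_leI)
      then show ?thesis using a(1) b by (auto simp: belief_mdp_simps)
    qed
  qed
  then show ?thesis using b0(2) lval_nonneg[OF nonneg_belief[OF b0(1)]] by (simp add: v_def)
qed

end

text \<open>Every path repeats \<open>s0\<close> forever, so the indicator of \<open>G\<close>
  serves for both martingale bounds.\<close>

lemma inf_reach_no_actions:
  assumes M: "mdp M" and s0: "s0 \<in> mstates M" and no: "mactions M = {}"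
  shows "inf_reach M s0 G = indicator G s0"
proof -
  have en: "enabled M s = {}" for s using no by (simp add: enabled_def)
  have "indicator G s0 \<le> ennreal (inf_reach M s0 G)"
    using inf_reach_ge[OF M s0, where f = "\<lambda>_. indicator G"] en by auto
  moreover have "ennreal (inf_reach M s0 G) \<le> indicator G s0"
    using inf_reach_le[OF M s0, where v = "indicator G"] en by auto
  moreover have "0 \<le> inf_reach M s0 G"
    unfolding inf_reach_def by (intro cINF_greatest schedulers_nonempty) simp
  ultimately show ?thesis by (auto simp: indicator_def split: if_splits)
qed

section \<open>The algorithm\<close>

lemma sum_digits_less:
  fixes B :: nat
  assumes "\<And>i. i < m \<Longrightarrow> f i < B"
  shows "(\<Sum>i<m. f i * B ^ i) < B ^ m"
  using assms
proof (induction m)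
  case (Suc m)
  then have "(\<Sum>i<m. f i * B ^ i) < B ^ m" "f m < B" by simp_all
  then have "(\<Sum>i<Suc m. f i * B ^ i) < B ^ m + f m * B ^ m" by simp
  also have "\<dots> = Suc (f m) * B ^ m" by simp
  also have "\<dots> \<le> B * B ^ m" using \<open>f m < B\<close> by (intro mult_le_mono1) simp
  finally show ?case by simp
qed simp

text \<open>Digits let one number hold a finite sequence: a primitive recursion can then carry a
  whole table, and a plan number can hold a subplan for each signal.\<close>

lemma digit_of_sum:
  fixes B :: nat
  assumes "\<And>i. i < m \<Longrightarrow> f i < B" "k < m"
  shows "(\<Sum>i<m. f i * B ^ i) div B ^ k mod B = f k"
  using assms
proof (induction m)
  case (Suc m)
  have B: "B > 0" using Suc.prems by (metis gr_zeroI not_less_zero)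
  have less: "(\<Sum>i<m. f i * B ^ i) < B ^ m" using Suc.prems by (intro sum_digits_less) simp
  show ?case
  proof (cases "k = m")
    case True
    then show ?thesis using less B Suc.prems(1)[of m] by simp
  next
    case False
    then have km: "k < m" using Suc.prems(2) by simp
    then obtain d where d: "m = k + Suc d" using less_iff_Suc_add by auto
    \<comment> \<open>The new term is a multiple of \<open>B * B ^ k\<close>, so it leaves digit
      \<open>k\<close> unchanged.\<close>
    have "(\<Sum>i<Suc m. f i * B ^ i) div B ^ k = ((\<Sum>i<m. f i * B ^ i) + (f m * B ^ d * B) * B ^ k) div B ^ k"
      by (simp add: d power_add mult_ac)
    also have "\<dots> = f m * B ^ d * B + (\<Sum>i<m. f i * B ^ i) div B ^ k"
      using B by (intro div_mult_self1) simp
    finally show ?thesis using Suc.IH[OF Suc.prems(1) km] by simp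
  qed
qed simp

section \<open>Enumeration and tabulation of plan trees\<close>

text \<open>The number of plan trees of depth \<open>n\<close>: a root action and one subtree for
  each of the \<open>O'\<close> signals.\<close>

primrec plan_count :: "nat \<Rightarrow> nat \<Rightarrow> nat \<Rightarrow> nat" where
  "plan_count A O' 0 = 1"
| "plan_count A O' (Suc n) = A * plan_count A O' n ^ O'"

text \<open>The plan with number \<open>j\<close> plays the action \<open>j mod A\<close> first; the base-\<open>plan_count A O' n\<close> digits
  of \<open>j div A\<close> are the numbers of the plans that it continues with after each signal.\<close>

primrec plan_vec :: "(nat \<Rightarrow> nat \<Rightarrow> nat \<Rightarrow> nat \<Rightarrow> nat) \<Rightarrow> nat \<Rightarrow> nat \<Rightarrow> nat \<Rightarrow> nat \<Rightarrow> nat \<Rightarrow> nat \<Rightarrow> nat \<Rightarrow> nat"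
  where
  "plan_vec T Q A O' g 0 j q = (if q = g then 1 else 0)"
| "plan_vec T Q A O' g (Suc n) j q = (\<Sum>s<O'. \<Sum>q'<Q. T q (j mod A) s q' *
    plan_vec T Q A O' g n (j div A div plan_count A O' n ^ s mod plan_count A O' n) q')"

lemma plan_count_pos: "A > 0 \<Longrightarrow> plan_count A O' n > 0"
  by (induction n) auto

text \<open>Row sums equal to \<open>D\<close> bound the growth per step, so
  \<open>Suc (D ^ n)\<close> is a large enough base for the table.\<close>

lemma plan_vec_le:
  assumes T: "\<And>q a. q < Q \<Longrightarrow> a < A \<Longrightarrow> (\<Sum>s<O'. \<Sum>q'<Q. T q a s q') = D" and "A > 0" "q < Q"
  shows "plan_vec T Q A O' g n j q \<le> D ^ n"
  using assms(3)
proof (induction n arbitrary: j q)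
  case (Suc n)
  have "plan_vec T Q A O' g (Suc n) j q \<le> (\<Sum>s<O'. \<Sum>q'<Q. T q (j mod A) s q' * D ^ n)"
    unfolding plan_vec.simps by (intro sum_mono mult_le_mono2 Suc.IH) simp
  also have "\<dots> = D ^ Suc n"
    using T[OF Suc.prems, of "j mod A"] assms(2) by (simp add: sum_distrib_right[symmetric])
  finally show ?case .
qed simp

text \<open>Entry \<open>j * Q + q\<close> of the table, that is the value of plan \<open>j\<close> in state \<open>q\<close>, is a base-\<open>B\<close> digit.\<close>

definition plan_table :: "(nat \<Rightarrow> nat \<Rightarrow> nat \<Rightarrow> nat \<Rightarrow> nat) \<Rightarrow> nat \<Rightarrow> nat \<Rightarrow> nat \<Rightarrow> nat \<Rightarrow> nat \<Rightarrow> nat \<Rightarrow> nat"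
  where
  "plan_table T Q A O' g B n = rec_nat (\<Sum>x<Q. (if x = g then 1 else 0) * B ^ x)
    (\<lambda>m y. \<Sum>x<plan_count A O' (Suc m) * Q. (\<Sum>s<O'. \<Sum>q'<Q. T (x mod Q) (x div Q mod A) s q' *
      (y div B ^ ((x div Q div A div plan_count A O' m ^ s mod plan_count A O' m) * Q + q') mod B)) * B ^ x) n"

text \<open>\<open>plan_vec\<close> calls itself with other plan numbers and states, whereas
  primitive recursion keeps its parameters; the table supplies all values of the previous depth at
  once.\<close>

lemma plan_table_digit:
  assumes T: "\<And>q a. q < Q \<Longrightarrow> a < A \<Longrightarrow> (\<Sum>s<O'. \<Sum>q'<Q. T q a s q') = D" and A: "A > 0" and D: "D > 0"
    and B: "D ^ n < B" and j: "j < plan_count A O' n" and q: "q < Q"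
  shows "plan_table T Q A O' g B n div B ^ (j * Q + q) mod B = plan_vec T Q A O' g n j q"
proof -
  have Q: "Q > 0" using q by simp
  \<comment> \<open>One base serves all depths up to \<open>n\<close>, since \<open>D ^ m\<close> is
    at most \<open>D ^ n\<close>.\<close>
  have less: "plan_vec T Q A O' g m j q < B" if "m \<le> n" "q < Q" for m j q
  proof -
    have "plan_vec T Q A O' g m j q \<le> D ^ m" using T A that(2) by (rule plan_vec_le)
    also have "\<dots> \<le> D ^ n" using D that(1) by (simp add: power_increasing)
    finally show ?thesis using B by simp
  qed
  have idx: "j * Q + q < plan_count A O' m * Q" if "j < plan_count A O' m" "q < Q" for j q m
  proof -
    have "j * Q + q < Suc j * Q" using that(2) by simp
    also have "\<dots> \<le> plan_count A O' m * Q" using that(1) by (intro mult_le_mono1) simp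
    finally show ?thesis .
  qed
  have digit: "(\<Sum>x<plan_count A O' m * Q. plan_vec T Q A O' g m (x div Q) (x mod Q) * B ^ x)
      div B ^ (j * Q + q) mod B = plan_vec T Q A O' g m j q"
    if "m \<le> n" "j < plan_count A O' m" "q < Q" for m j q
    using less[OF that(1)] idx[OF that(2,3)] that(3)
    by (subst digit_of_sum) auto
  have "plan_table T Q A O' g B m
      = (\<Sum>x<plan_count A O' m * Q. plan_vec T Q A O' g m (x div Q) (x mod Q) * B ^ x)" if "m \<le> n" for m
    using that
  proof (induction m)
    case (Suc m)
    have step: "plan_table T Q A O' g B (Suc m) = (\<Sum>x<plan_count A O' (Suc m) * Q.
      (\<Sum>s<O'. \<Sum>q'<Q. T (x mod Q) (x div Q mod A) s q' * (plan_table T Q A O' g B m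
        div B ^ ((x div Q div A div plan_count A O' m ^ s mod plan_count A O' m) * Q + q') mod B)) * B ^ x)"
      by (simp add: plan_table_def)
    have dig: "plan_table T Q A O' g B m div B ^ ((k mod plan_count A O' m) * Q + q') mod B
        = plan_vec T Q A O' g m (k mod plan_count A O' m) q'" if "q' < Q" for k q'
      using Suc that plan_count_pos[OF A] by (subst Suc.IH) (simp_all add: digit)
    show ?case unfolding step plan_vec.simps
      by (intro sum.cong refl arg_cong2[where f = "(*)"] dig) simp
  qed (simp add: plan_table_def)
  then show ?thesis using digit[OF order_refl j q] by simp
qed

lemma sum_set_nth: "distinct xs \<Longrightarrow> sum f (set xs) = (\<Sum>i<length xs. f (xs ! i))"
  by (subst sum.reindex_bij_betw[OF bij_betw_nth, symmetric, of xs "{..<length xs}"]) auto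

context pomdp_model
begin

text \<open>A plan chooses its subplans independently for each signal, so the minimum over plans
  distributes over the sum over signals.\<close>

lemma val_plan_vec:
  assumes qs: "distinct qs" "set qs = Q" and as: "distinct acts" "set acts = A" and ss: "distinct sigs" "set sigs = S"
    and g: "gi < length qs" "qs ! gi = g"
    and T: "\<And>q a s q'. q < length qs \<Longrightarrow> a < length acts \<Longrightarrow> s < length sigs \<Longrightarrow> q' < length qs \<Longrightarrow>
      real (T q a s q') = real D * pr (qs ! q) (acts ! a) (sigs ! s) (qs ! q')"
  shows "real D ^ n * val P n \<alpha> = (MIN j\<in>{..<plan_count (length acts) (length sigs) n}.
    \<Sum>q<length qs. \<alpha> (qs ! q) * real (plan_vec T (length qs) (length acts) (length sigs) gi n j q))"
proof (induction n arbitrary: \<alpha>)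
  case 0
  have "(\<Sum>q<length qs. \<alpha> (qs ! q) * real (if q = gi then 1 else 0)) = (\<Sum>q<length qs. if q = gi then \<alpha> (qs ! q) else 0)"
    by (intro sum.cong) auto
  also have "\<dots> = \<alpha> g" using g by simp
  finally show ?case by (simp add: lessThan_Suc)
next
  case (Suc n)
  let ?Q = "length qs" and ?A = "length acts" and ?O = "length sigs"
  let ?c = "plan_count ?A ?O n" and ?v = "plan_vec T ?Q ?A ?O gi"
  define F where "F j \<alpha> = (\<Sum>q<?Q. \<alpha> (qs ! q) * real (?v n j q))" for j \<alpha>
  have A0: "?A > 0" using acts as by auto
  have c0: "?c > 0" using A0 by (rule plan_count_pos)
  have IH: "real D ^ n * val P n \<beta> = Min ((\<lambda>j. F j \<beta>) ` {..<?c})" for \<beta>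
    using Suc.IH by (simp add: F_def)
  have IH_le: "real D ^ n * val P n \<beta> \<le> F j \<beta>" if "j < ?c" for j \<beta>
    unfolding IH using that by (intro Min_le) auto
  have IH_ex: "\<exists>j<?c. real D ^ n * val P n \<beta> = F j \<beta>" for \<beta>
  proof -
    have "real D ^ n * val P n \<beta> \<in> (\<lambda>j. F j \<beta>) ` {..<?c}"
      unfolding IH using c0 by (intro Min_in) auto
    then show ?thesis by auto
  qed
  define G where "G j = (\<Sum>q<?Q. \<alpha> (qs ! q) * real (?v (Suc n) j q))" for j
  have G: "G j = (\<Sum>s<?O. real D * F (j div ?A div ?c ^ s mod ?c) (push P \<alpha> (acts ! (j mod ?A)) (sigs ! s)))" for j
  proof -
    have a: "j mod ?A < ?A" using A0 by simp
    let ?k = "\<lambda>s. j div ?A div ?c ^ s mod ?c"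
    have "G j = (\<Sum>q<?Q. \<Sum>s<?O. \<Sum>q'<?Q. \<alpha> (qs ! q) * (real (T q (j mod ?A) s q') * real (?v n (?k s) q')))"
      by (simp add: G_def sum_distrib_left)
    also have "\<dots> = (\<Sum>q<?Q. \<Sum>s<?O. \<Sum>q'<?Q. real D * (\<alpha> (qs ! q) * pr (qs ! q) (acts ! (j mod ?A)) (sigs ! s) (qs ! q')
        * real (?v n (?k s) q')))"
      using a by (intro sum.cong refl) (simp add: T mult_ac)
    \<comment> \<open>The sum over the current state moves innermost, where it forms
      \<open>push\<close>.\<close>
    also have "\<dots> = (\<Sum>s<?O. \<Sum>q'<?Q. \<Sum>q<?Q. real D * (\<alpha> (qs ! q) * pr (qs ! q) (acts ! (j mod ?A)) (sigs ! s) (qs ! q')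
        * real (?v n (?k s) q')))"
      by (subst sum.swap) (intro sum.cong refl sum.swap)
    also have "\<dots> = (\<Sum>s<?O. real D * F (?k s) (push P \<alpha> (acts ! (j mod ?A)) (sigs ! s)))"
      by (simp add: F_def push_def qs(2)[symmetric] sum_set_nth[OF qs(1)] sum_distrib_left sum_distrib_right mult.assoc)
    finally show ?thesis .
  qed
  have sumS: "(\<Sum>s\<in>S. f s) = (\<Sum>s<?O. f (sigs ! s))" for f :: "'o \<Rightarrow> real"
    unfolding ss(2)[symmetric] by (rule sum_set_nth[OF ss(1)])
  have "Min (G ` {..<plan_count ?A ?O (Suc n)}) = real D ^ Suc n * val P (Suc n) \<alpha>"
  proof (rule Min_eqI)
    fix y assume "y \<in> G ` {..<plan_count ?A ?O (Suc n)}"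
    then obtain j where j: "y = G j" by blast
    have a: "acts ! (j mod ?A) \<in> A" using A0 as by (metis mod_less_divisor nth_mem)
    have "real D ^ Suc n * val P (Suc n) \<alpha>
        \<le> real D ^ Suc n * (\<Sum>s\<in>S. val P n (push P \<alpha> (acts ! (j mod ?A)) s))"
      by (intro mult_left_mono val_Suc_le[OF a]) simp
    also have "\<dots> = (\<Sum>s<?O. real D * (real D ^ n * val P n (push P \<alpha> (acts ! (j mod ?A)) (sigs ! s))))"
      by (simp add: sumS sum_distrib_left mult_ac)
    also have "\<dots> \<le> y"
      unfolding j G using c0 by (intro sum_mono mult_left_mono IH_le) auto
    finally show "real D ^ Suc n * val P (Suc n) \<alpha> \<le> y" .
  next
    obtain a where a: "a \<in> A" "val P (Suc n) \<alpha> = (\<Sum>s\<in>S. val P n (push P \<alpha> a s))"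
      by (rule val_Suc_attained)
    obtain i where i: "i < ?A" "acts ! i = a" using a(1) as(2) by (metis in_set_conv_nth)
    have "\<forall>s. \<exists>j. j < ?c \<and> real D ^ n * val P n (push P \<alpha> a (sigs ! s)) = F j (push P \<alpha> a (sigs ! s))"
      using IH_ex by blast
    from choice[OF this] obtain k where k: "\<And>s. k s < ?c"
      "\<And>s. real D ^ n * val P n (push P \<alpha> a (sigs ! s)) = F (k s) (push P \<alpha> a (sigs ! s))"
      by blast
    \<comment> \<open>The optimal plan has the optimal root action \<open>i\<close>; the digits of
      \<open>K\<close> are optimal subplans \<open>k s\<close> after the signals.\<close>
    define K where "K = (\<Sum>s<?O. k s * ?c ^ s)"
    define j where "j = i + ?A * K"
    have K: "K < ?c ^ ?O" unfolding K_def using k(1) by (intro sum_digits_less) auto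
    have "j < ?A * Suc K" using i(1) by (simp add: j_def)
    also have "\<dots> \<le> plan_count ?A ?O (Suc n)" using K by (simp del: mult_Suc_right)
    finally have j: "j < plan_count ?A ?O (Suc n)" .
    have ji: "j mod ?A = i" "j div ?A = K"
      unfolding j_def using i(1) A0 by (simp, subst div_mult_self2, auto)
    have dig: "K div ?c ^ s mod ?c = k s" if "s < ?O" for s
      unfolding K_def using k(1) that by (intro digit_of_sum) auto
    have "real D ^ Suc n * val P (Suc n) \<alpha> = (\<Sum>s<?O. real D * (real D ^ n * val P n (push P \<alpha> a (sigs ! s))))"
      unfolding a(2) by (simp add: sumS sum_distrib_left mult_ac)
    also have "\<dots> = G j" unfolding G ji i(2) by (intro sum.cong refl) (simp add: dig k(2))
    finally show "real D ^ Suc n * val P (Suc n) \<alpha> \<in> G ` {..<plan_count ?A ?O (Suc n)}" using j by blast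
  qed simp
  then show ?case unfolding G_def[abs_def] by (rule sym)
qed

end

section \<open>The program\<close>

definition common_denom :: "nat \<Rightarrow> nat \<Rightarrow> nat" where
  "common_denom t L = (\<Prod>j<L. Suc (snd (prod_decode (code_nth t j))))"

text \<open>Halving decodes the numerator, because nonnegative integers have even codes; the index
  is the position in the lexicographic table.\<close>

definition trans_num :: "nat \<Rightarrow> nat \<Rightarrow> nat \<Rightarrow> nat \<Rightarrow> nat \<Rightarrow> nat \<Rightarrow> nat \<Rightarrow> nat \<Rightarrow> nat \<Rightarrow> nat" where
  "trans_num t Q A O' D q a s q' =
    fst (prod_decode (code_nth t (((q * A + a) * O' + s) * Q + q'))) div 2 * D
      div Suc (snd (prod_decode (code_nth t (((q * A + a) * O' + s) * Q + q'))))"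

text \<open>The number of steps in \<open>lval_le_val\<close>: blocks of \<open>2 ^ Q\<close> steps,
  preceded by the number of blocks.\<close>

definition horizon :: "nat \<Rightarrow> nat \<Rightarrow> nat \<Rightarrow> nat" where
  "horizon E Q D = E * (E * Q * D ^ (2 ^ Q)) * 2 ^ Q"

text \<open>The base exceeds every table entry, and the bound \<open>plan_count A O' n - 1\<close>
  gives the closed range that \<open>computable_Min\<close> handles.\<close>

definition approx_num :: "nat \<Rightarrow> nat \<Rightarrow> nat \<Rightarrow> nat \<Rightarrow> nat \<Rightarrow> nat \<Rightarrow> nat \<Rightarrow> nat \<Rightarrow> nat" where
  "approx_num t Q A O' D i g n = (MIN j\<in>{..plan_count A O' n - 1}.
    plan_table (trans_num t Q A O' D) Q A O' g (Suc (D ^ n)) n div Suc (D ^ n) ^ (j * Q + i) mod Suc (D ^ n))"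

text \<open>Doubling codes a nonnegative numerator; the second component is the denominator minus 1.
  Without actions the answer is 1 or 0.\<close>

definition approx_code :: "nat \<Rightarrow> nat \<Rightarrow> nat \<Rightarrow> nat \<Rightarrow> nat \<Rightarrow> nat \<Rightarrow> nat \<Rightarrow> nat \<Rightarrow> nat" where
  "approx_code t Q A O' D i g n = (if A = 0 then prod_encode (if i = g then 2 else 0, 0)
    else prod_encode (2 * approx_num t Q A O' D i g n, D ^ n - 1))"

lemma computable_plan_count [computable]:
  assumes [computable]: "computable ps A" "computable ps O'" "computable ps n"
  shows "computable ps (\<lambda>e. plan_count (A e) (O' e) (n e))"
proof -
  have "plan_count a s m = rec_nat 1 (\<lambda>_ y. a * y ^ s) m" for a s m by (induction m) auto
  then show ?thesis by (simp only:) (intro computable)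
qed

lemma computable_common_denom [computable]:
  assumes [computable]: "computable ps t" "computable ps L"
  shows "computable ps (\<lambda>e. common_denom (t e) (L e))"
  unfolding common_denom_def by (intro computable)

lemma computable_trans_num [computable]:
  assumes [computable]: "computable ps t" "computable ps Q" "computable ps A" "computable ps O'"
    "computable ps D" "computable ps q" "computable ps a" "computable ps s" "computable ps q'"
  shows "computable ps (\<lambda>e. trans_num (t e) (Q e) (A e) (O' e) (D e) (q e) (a e) (s e) (q' e))"
  unfolding trans_num_def by (intro computable)

lemma computable_horizon [computable]:
  assumes [computable]: "computable ps E" "computable ps Q" "computable ps D"
  shows "computable ps (\<lambda>e. horizon (E e) (Q e) (D e))"
  unfolding horizon_def by (intro computable)

lemma computable_plan_table [computable]:
  assumes [computable]: "computable ps t" "computable ps Q" "computable ps A" "computable ps O'"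
    "computable ps D" "computable ps g" "computable ps B" "computable ps n"
  shows "computable ps (\<lambda>e. plan_table (trans_num (t e) (Q e) (A e) (O' e) (D e))
    (Q e) (A e) (O' e) (g e) (B e) (n e))"
  unfolding plan_table_def by (intro computable)

lemma computable_approx_code [computable]:
  assumes [computable]: "computable ps t" "computable ps Q" "computable ps A" "computable ps O'"
    "computable ps D" "computable ps i" "computable ps g" "computable ps n"
  shows "computable ps (\<lambda>e. approx_code (t e) (Q e) (A e) (O' e) (D e) (i e) (g e) (n e))"
  unfolding approx_code_def approx_num_def by (intro computable)

section \<open>Decoding the input and correctness\<close>

lemma length_concat_const: "(\<And>x. x \<in> set xs \<Longrightarrow> length (f x) = k) \<Longrightarrow> length (concat (map f xs)) = length xs * k"
  by (induction xs) auto

lemma nth_concat_const: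
  assumes "\<And>x. x \<in> set xs \<Longrightarrow> length (f x) = k" "i < length xs" "j < k"
  shows "concat (map f xs) ! (i * k + j) = f (xs ! i) ! j"
  using assms
proof (induction xs arbitrary: i)
  case (Cons x xs)
  then show ?case by (cases i) (auto simp: nth_append)
qed simp

lemma rat_of_code_nonneg:
  assumes "0 \<le> rat_of_code c"
  shows "rat_of_code c = of_nat (fst (prod_decode c) div 2) / of_nat (Suc (snd (prod_decode c)))"
proof -
  obtain m n where mn: "prod_decode c = (m, n)" by (cases "prod_decode c")
  have "0 \<le> int_decode m"
    using assms by (simp add: rat_of_code_def mn zero_le_divide_iff del: of_nat_Suc)
  then have "int_decode m = int (m div 2)"
    by (auto simp: int_decode_def sum_decode_def split: if_splits)
  then show ?thesis by (simp add: rat_of_code_def mn)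
qed

lemma rat_of_code_even: "rat_of_code (prod_encode (2 * v, n)) = of_nat v / of_nat (Suc n)"
  by (simp add: rat_of_code_def int_decode_def sum_decode_def)

lemma index_less: "a < m \<Longrightarrow> b < n \<Longrightarrow> a * n + b < m * n" for a b m n :: nat
proof -
  assume "a < m" "b < n"
  then have "a * n + b < Suc a * n" by simp
  also have "\<dots> \<le> m * n" using \<open>a < m\<close> by (intro mult_le_mono1) simp
  finally show ?thesis .
qed

text \<open>Both divisions in \<open>trans_num\<close> are exact: the numerator has an even code,
  and the denominator divides \<open>D\<close>.\<close>

lemma of_nat_trans_num:
  assumes "0 \<le> rat_of_code (code_nth t (((q * A + a) * O' + s) * Q + q'))"
    and "Suc (snd (prod_decode (code_nth t (((q * A + a) * O' + s) * Q + q')))) dvd D"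
  shows "real (trans_num t Q A O' D q a s q')
    = real D * real_of_rat (rat_of_code (code_nth t (((q * A + a) * O' + s) * Q + q')))"
proof -
  define c where "c = code_nth t (((q * A + a) * O' + s) * Q + q')"
  define x y where "x = fst (prod_decode c) div 2" and "y = Suc (snd (prod_decode c))"
  obtain k where k: "D = y * k" using assms(2) by (auto simp: y_def c_def)
  have y: "y > 0" by (simp add: y_def)
  have "rat_of_code c = of_nat x / of_nat y"
    unfolding x_def y_def using assms(1) by (intro rat_of_code_nonneg) (simp add: c_def)
  then have "real D * real_of_rat (rat_of_code c) = real (x * k)"
    using y by (simp add: k of_rat_divide)
  moreover have "trans_num t Q A O' D q a s q' = x * (y * k) div y"
    by (simp only: trans_num_def c_def[symmetric] x_def[symmetric] y_def[symmetric] k)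
  moreover have "x * (y * k) div y = x * k" using y by (simp add: mult.left_commute)
  ultimately show ?thesis by (simp add: c_def)
qed

lemma length_table:
  "length [f q a s q'. q \<leftarrow> qs, a \<leftarrow> acts, s \<leftarrow> sigs, q' \<leftarrow> qs]
    = length qs * length acts * length sigs * length qs"
proof -
  have 1: "length [f q a s q'. s \<leftarrow> sigs, q' \<leftarrow> qs] = length sigs * length qs" for q a
    by (rule length_concat_const) simp
  have 2: "length [f q a s q'. a \<leftarrow> acts, s \<leftarrow> sigs, q' \<leftarrow> qs] = length acts * (length sigs * length qs)" for q
    by (rule length_concat_const) (rule 1)
  show ?thesis unfolding mult.assoc by (rule length_concat_const) (rule 2)
qed

lemma nth_table:
  assumes "i < length qs" "j < length acts" "k < length sigs" "l < length qs"
  shows "[f q a s q'. q \<leftarrow> qs, a \<leftarrow> acts, s \<leftarrow> sigs, q' \<leftarrow> qs]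
    ! (((i * length acts + j) * length sigs + k) * length qs + l) = f (qs ! i) (acts ! j) (sigs ! k) (qs ! l)"
proof -
  let ?Q = "length qs" and ?A = "length acts" and ?O = "length sigs"
  have l1: "length [f q a s q'. s \<leftarrow> sigs, q' \<leftarrow> qs] = ?O * ?Q" for q a
    by (rule length_concat_const) simp
  have l2: "length [f q a s q'. a \<leftarrow> acts, s \<leftarrow> sigs, q' \<leftarrow> qs] = ?A * (?O * ?Q)" for q
    by (rule length_concat_const) (rule l1)
  have lt1: "k * ?Q + l < ?O * ?Q" using assms by (intro index_less)
  have lt2: "j * (?O * ?Q) + (k * ?Q + l) < ?A * (?O * ?Q)" using assms lt1 by (intro index_less)
  have idx: "((i * ?A + j) * ?O + k) * ?Q + l = i * (?A * (?O * ?Q)) + (j * (?O * ?Q) + (k * ?Q + l))"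
    by (simp add: algebra_simps)
  have "[f q a s q'. q \<leftarrow> qs, a \<leftarrow> acts, s \<leftarrow> sigs, q' \<leftarrow> qs] ! (((i * ?A + j) * ?O + k) * ?Q + l)
    = [f (qs ! i) a s q'. a \<leftarrow> acts, s \<leftarrow> sigs, q' \<leftarrow> qs] ! (j * (?O * ?Q) + (k * ?Q + l))"
    unfolding idx by (rule nth_concat_const[OF l2 assms(1) lt2])
  also have "\<dots> = [f (qs ! i) (acts ! j) s q'. s \<leftarrow> sigs, q' \<leftarrow> qs] ! (k * ?Q + l)"
    by (rule nth_concat_const[OF l1 assms(2) lt1])
  also have "\<dots> = map (f (qs ! i) (acts ! j) (sigs ! k)) qs ! l"
    by (rule nth_concat_const[OF _ assms(3,4)]) simp
  finally show ?thesis using assms(4) by simp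
qed

lemma approx_code_correct:
  fixes P :: "('q, 'a, 'o) pomdp"
  assumes P: "pomdp P" and \<epsilon>: "rat_of_code e > 0"
    and qs: "distinct qs" "set qs = pstates P" and as: "distinct acts" "set acts = pactions P"
    and ss: "distinct sigs" "set sigs = psignals P"
    and i: "i < length qs" and g: "g < length qs" "qs ! g = pgoal P"
    and t: "map rat_of_code t = [ptrans P q a s q'. q \<leftarrow> qs, a \<leftarrow> acts, s \<leftarrow> sigs, q' \<leftarrow> qs]"
  defines "Q \<equiv> length qs" and "A \<equiv> length acts" and "O' \<equiv> length sigs" and "c \<equiv> list_encode t"
  defines "D \<equiv> common_denom c (Q * A * O' * Q)"
  defines "n \<equiv> horizon (2 * Suc (snd (prod_decode e))) Q D"
  shows "\<bar>real_of_rat (rat_of_code (approx_code c Q A O' D i g n))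
    - inf_reach (belief_mdp P) (point_belief (qs ! i)) {point_belief (pgoal P)}\<bar> \<le> real_of_rat (rat_of_code e)"
proof -
  let ?b = "point_belief (qs ! i) :: 'q \<Rightarrow> rat" and ?G = "{point_belief (pgoal P)} :: ('q \<Rightarrow> rat) set"
  \<comment> \<open>A positive \<epsilon> is at least 1 over its coded denominator, that is
    \<open>2 / E\<close>, which is the relative error in \<open>lval_le_val\<close>.\<close>
  define E where "E = 2 * Suc (snd (prod_decode e))"
  have E0: "E > 0" by (simp add: E_def)
  have \<epsilon>_ge: "2 / real E \<le> real_of_rat (rat_of_code e)"
  proof -
    have eq: "rat_of_code e = of_nat (fst (prod_decode e) div 2) / of_nat (Suc (snd (prod_decode e)))"
      using \<epsilon> by (intro rat_of_code_nonneg) simp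
    have "fst (prod_decode e) div 2 \<noteq> 0"
    proof
      assume "fst (prod_decode e) div 2 = 0"
      with eq \<epsilon> show False by simp
    qed
    then have "1 \<le> real (fst (prod_decode e) div 2)" by simp
    then have "2 / real E \<le> real (fst (prod_decode e) div 2) / real (Suc (snd (prod_decode e)))"
      unfolding E_def of_nat_mult by (simp add: divide_right_mono del: of_nat_Suc)
    also have "\<dots> = real_of_rat (rat_of_code e)" by (simp add: eq of_rat_divide del: of_nat_Suc)
    finally show ?thesis .
  qed
  have "qs ! i \<in> pstates P" unfolding qs(2)[symmetric] using i by (rule nth_mem)
  with P have b: "?b \<in> beliefs P" by (rule point_belief_in_beliefs)
  show ?thesis
  proof (cases "A = 0")
    case True
    then have no: "mactions (belief_mdp P) = {}" using as by (simp add: A_def belief_mdp_def)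
    have "inf_reach (belief_mdp P) ?b ?G = indicator ?G ?b"
      using b no by (intro inf_reach_no_actions mdp_belief_mdp P) (simp_all add: belief_mdp_def)
    also have "\<dots> = (if i = g then 1 else 0)"
      using qs(1) i g by (auto simp: indicator_def point_belief_def fun_eq_iff nth_eq_iff_index_eq split: if_splits)
    also have "\<dots> = real_of_rat (rat_of_code (approx_code c Q A O' D i g n))"
      using rat_of_code_even[of 1 0] rat_of_code_even[of 0 0] True by (simp add: approx_code_def)
    finally show ?thesis using \<epsilon> by simp
  next
    case False
    interpret pomdp_model P using False as P by unfold_locales (auto simp: A_def)
    let ?L = "Q * A * O' * Q"
    let ?idx = "\<lambda>q a s q'. ((q * A + a) * O' + s) * Q + q'"
    have len_t: "length t = ?L"
      using arg_cong[OF t, of length] by (simp only: length_map length_table Q_def A_def O'_def)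
    have idx: "?idx q a s q' < ?L"
      and nth: "rat_of_code (code_nth c (?idx q a s q')) = ptrans P (qs ! q) (acts ! a) (sigs ! s) (qs ! q')"
      if q: "q < Q" "a < A" "s < O'" "q' < Q" for q a s q'
    proof -
      show lt: "?idx q a s q' < ?L" using q by (intro index_less)
      then have "rat_of_code (code_nth c (?idx q a s q')) = map rat_of_code t ! ?idx q a s q'"
        by (simp only: c_def code_nth_list_encode nth_map len_t)
      also have "\<dots> = ptrans P (qs ! q) (acts ! a) (sigs ! s) (qs ! q')"
        using q unfolding t Q_def A_def O'_def by (rule nth_table)
      finally show "rat_of_code (code_nth c (?idx q a s q')) = ptrans P (qs ! q) (acts ! a) (sigs ! s) (qs ! q')" .
    qed
    have D0: "D > 0" by (simp add: D_def common_denom_def prod_pos)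
    have T: "real (trans_num c Q A O' D q a s q') = real D * pr (qs ! q) (acts ! a) (sigs ! s) (qs ! q')"
      if q: "q < Q" "a < A" "s < O'" "q' < Q" for q a s q'
    proof -
      have "0 \<le> ptrans P (qs ! q) (acts ! a) (sigs ! s) (qs ! q')"
        using q qs as ss by (intro ptrans_nonneg) (auto simp: Q_def A_def O'_def)
      moreover have "Suc (snd (prod_decode (code_nth c (?idx q a s q')))) dvd D"
        unfolding D_def common_denom_def using idx[OF q] by (intro dvd_prodI) auto
      ultimately show ?thesis unfolding nth[OF q, symmetric] by (rule of_nat_trans_num)
    qed
    have Tsum: "(\<Sum>s<O'. \<Sum>q'<Q. trans_num c Q A O' D q a s q') = D" if q: "q < Q" "a < A" for q a
    proof -
      have "real (\<Sum>s<O'. \<Sum>q'<Q. trans_num c Q A O' D q a s q')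
          = real D * (\<Sum>s<O'. \<Sum>q'<Q. pr (qs ! q) (acts ! a) (sigs ! s) (qs ! q'))"
        unfolding of_nat_sum sum_distrib_left
        by (rule sum.cong[OF refl], rule sum.cong[OF refl], rule T) (use q in auto)
      also have "(\<Sum>s<O'. \<Sum>q'<Q. pr (qs ! q) (acts ! a) (sigs ! s) (qs ! q'))
          = (\<Sum>s\<in>S. \<Sum>q'\<in>pstates P. pr (qs ! q) (acts ! a) s q')"
        unfolding ss(2)[symmetric] qs(2)[symmetric] sum_set_nth[OF ss(1)] sum_set_nth[OF qs(1)] Q_def O'_def ..
      also have "\<dots> = 1" using q qs as by (intro pr_sum) (auto simp: Q_def A_def)
      finally show ?thesis by (simp only: mult_1_right of_nat_eq_iff)
    qed
    have DT: "real D * pr q a s q' \<in> \<nat>" if mem: "q \<in> pstates P" "a \<in> pactions P" "s \<in> S" "q' \<in> pstates P" for q a s q'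
    proof -
      obtain j where j: "j < length qs" "qs ! j = q"
        using mem(1) unfolding qs(2)[symmetric] in_set_conv_nth by blast
      obtain k where k: "k < length acts" "acts ! k = a"
        using mem(2) unfolding as(2)[symmetric] in_set_conv_nth by blast
      obtain l where l: "l < length sigs" "sigs ! l = s"
        using mem(3) unfolding ss(2)[symmetric] in_set_conv_nth by blast
      obtain m where m: "m < length qs" "qs ! m = q'"
        using mem(4) unfolding qs(2)[symmetric] in_set_conv_nth by blast
      have "real D * pr (qs ! j) (acts ! k) (sigs ! l) (qs ! m) = real (trans_num c Q A O' D j k l m)"
        using j(1) k(1) l(1) m(1) by (intro T[symmetric]) (simp_all only: Q_def A_def O'_def)
      then show ?thesis unfolding j(2) k(2) l(2) m(2) by (simp only: of_nat_in_Nats)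
    qed
    have cardQ: "card (pstates P) = Q" using distinct_card[OF qs(1)] unfolding qs(2) Q_def .
    have n: "n = E * (E * card (pstates P) * D ^ 2 ^ card (pstates P)) * 2 ^ card (pstates P)"
      by (simp add: n_def horizon_def E_def cardQ)
    have cons: "consistent (rb ?b)" by (auto simp: consistent_def point_belief_def)
    have lower: "val P n (rb ?b) \<le> inf_reach (belief_mdp P) ?b ?G"
      using b cons by (rule val_le_inf_reach)
    have "inf_reach (belief_mdp P) ?b ?G \<le> lval P (rb ?b)"
      using b cons by (rule inf_reach_le_lval)
    also have "\<dots> \<le> val P n (rb ?b) + 2 / real E * mass (rb ?b)"
      unfolding n using DT D0 E0 nonneg_belief[OF b] cons by (rule lval_le_val)
    finally have upper: "inf_reach (belief_mdp P) ?b ?G \<le> val P n (rb ?b) + 2 / real E"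
      by (simp add: mass_belief[OF b])
    let ?N = "plan_count A O' n"
    have N0: "?N > 0" using False by (intro plan_count_pos) simp
    then have set_eq: "{..?N - 1} = {..<?N}" by auto
    have "real (approx_num c Q A O' D i g n)
        = real (MIN j\<in>{..<?N}. plan_vec (trans_num c Q A O' D) Q A O' g n j i)"
      unfolding approx_num_def set_eq using False i
      by (intro arg_cong[where f = real] arg_cong[where f = Min] image_cong refl
          plan_table_digit[OF Tsum _ D0]) (auto simp: Q_def)
    also have "\<dots> = (MIN j\<in>{..<?N}. real (plan_vec (trans_num c Q A O' D) Q A O' g n j i))"
      using N0 by (subst mono_Min_commute[where f = real]) (auto simp: mono_def image_image)
    \<comment> \<open>The start is a point belief, so the linear functional of a plan evaluates to
      its entry at \<open>i\<close>.\<close>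
    also have "\<dots> = (MIN j\<in>{..<?N}. \<Sum>q<Q. rb ?b (qs ! q) * real (plan_vec (trans_num c Q A O' D) Q A O' g n j q))"
    proof -
      have "rb ?b (qs ! q) = (if q = i then 1 else 0)" if "q < Q" for q
        using that qs(1) i by (simp add: point_belief_def nth_eq_iff_index_eq Q_def)
      then have "(\<Sum>q<Q. rb ?b (qs ! q) * f q) = f i" for f :: "nat \<Rightarrow> real"
        using i by (simp add: if_distrib[where f = "\<lambda>x. x * _"] Q_def cong: if_cong)
      then show ?thesis by simp
    qed
    also have "\<dots> = real D ^ n * val P n (rb ?b)"
      unfolding Q_def A_def O'_def
      by (rule val_plan_vec[symmetric, OF qs as ss g]) (rule T[unfolded Q_def A_def O'_def])
    finally have num: "real (approx_num c Q A O' D i g n) = real D ^ n * val P n (rb ?b)" .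
    \<comment> \<open>As \<open>D\<close> is positive, the second component \<open>D ^ n - 1\<close>
      stands for the denominator \<open>D ^ n\<close>.\<close>
    have "real_of_rat (rat_of_code (approx_code c Q A O' D i g n))
        = real (approx_num c Q A O' D i g n) / real (D ^ n)"
      using False D0 by (simp add: approx_code_def rat_of_code_even of_rat_divide of_rat_power del: of_nat_Suc)
    also have "\<dots> = val P n (rb ?b)" using D0 by (simp add: num)
    finally show ?thesis using lower upper \<epsilon>_ge by linarith
  qed
qed

theorem theorem10:
  shows "\<exists>A :: recf. \<forall>(P :: (nat, nat, nat) pomdp) q0 \<epsilon> x.
    pomdp P \<longrightarrow> q0 \<in> pstates P \<longrightarrow> \<epsilon> > 0 \<longrightarrow> encodes x P q0 \<epsilon> \<longrightarrow>
    (\<exists>y. eval A x y \<and>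
      \<bar>real_of_rat (rat_of_code y)
        - inf_reach (belief_mdp P) (point_belief q0) {point_belief (pgoal P)}\<bar> \<le> real_of_rat \<epsilon>)"
proof -
  let ?D = "\<lambda>xs. common_denom (xs ! 7) (xs ! 1 * xs ! 2 * xs ! 3 * xs ! 1)"
  let ?f = "\<lambda>xs. approx_code (xs ! 7) (xs ! 1) (xs ! 2) (xs ! 3) (?D xs) (xs ! 4) (xs ! 5)
    (horizon (2 * Suc (snd (prod_decode (xs ! 0)))) (xs ! 1) (?D xs))"
  \<comment> \<open>The environment is the input list itself, and its eight components are the
    arguments of the program.\<close>
  let ?ps = "map (\<lambda>j xs. xs ! j) [0..<8] :: (nat list \<Rightarrow> nat) list"
  have var [computable]: "computable ?ps (\<lambda>xs. xs ! j)" if "j < 8" for j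
    using that by (intro computable_var) auto
  have "computable ?ps ?f" by (intro computable) simp_all
  then obtain A where A: "\<And>xs. eval A (map (\<lambda>p. p xs) ?ps) (?f xs)"
    unfolding computable_def by blast
  show ?thesis
  proof (intro exI[of _ A] allI impI)
    fix P :: "(nat, nat, nat) pomdp" and q0 \<epsilon> x
    assume P: "pomdp P" and \<epsilon>: "\<epsilon> > 0" and "encodes x P q0 \<epsilon>"
    then obtain qs acts sigs e i g k t where enc: "distinct qs" "set qs = pstates P"
      "distinct acts" "set acts = pactions P" "distinct sigs" "set sigs = psignals P"
      "rat_of_code e = \<epsilon>" "i < length qs" "qs ! i = q0" "g < length qs" "qs ! g = pgoal P"
      "map rat_of_code t = [ptrans P q a s q'. q \<leftarrow> qs, a \<leftarrow> acts, s \<leftarrow> sigs, q' \<leftarrow> qs]"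
      "x = [e, length qs, length acts, length sigs, i, g, k, list_encode t]"
      unfolding encodes_def by blast
    \<comment> \<open>An encoding has exactly eight components, so the argument list is
      \<open>x\<close> again.\<close>
    have "map (\<lambda>p. p x) ?ps = x" by (simp add: enc(13) upt_rec)
    with A[of x] have "eval A x (?f x)" by simp
    moreover have "\<bar>real_of_rat (rat_of_code (?f x))
        - inf_reach (belief_mdp P) (point_belief q0) {point_belief (pgoal P)}\<bar> \<le> real_of_rat \<epsilon>"
      using approx_code_correct[OF P _ enc(1-6,8,10-12), of e] \<epsilon> by (simp add: enc(7,9,13))
    ultimately show "\<exists>y. eval A x y \<and> \<bar>real_of_rat (rat_of_code y)
        - inf_reach (belief_mdp P) (point_belief q0) {point_belief (pgoal P)}\<bar> \<le> real_of_rat \<epsilon>"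
      by blast
  qed
qed

end
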